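(* The quaternary quadratic form $Q_{19}^2=x^2+2y^2+3z^2+4w^2+2zw+2yw$ (Gram matrix $\begin{pmatrix}1&0&0&0\\0&2&0&1\\0&0&3&1\\0&1&1&4\end{pmatrix}$) is primitively universal.
   Context: A quadratic form $f$ in variables $x,y,z,w$ is primitively universal if for every positive integer $n$ the equation $f(x,y,z,w)=n$ has an integer solution with $\gcd(x,y,z,w)=1$. *)

theory Defs
  imports Main
begin

definition primitively_universal :: "(int \<Rightarrow> int \<Rightarrow> int \<Rightarrow> int \<Rightarrow> int) \<Rightarrow> bool" where
  "primitively_universal f \<longleftrightarrow>
     (\<forall>n>0. \<exists>x y z w. f x y z w = n \<and> Gcd {x, y, z, w} = 1)"

(* The superscript in Q_19^2 is an index, not a square; the form has determinant 19. *)
definition Q19_2 :: "int \<Rightarrow> int \<Rightarrow> int \<Rightarrow> int \<Rightarrow> int" where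
  "Q19_2 x y z w = x\<^sup>2 + 2 * y\<^sup>2 + 3 * z\<^sup>2 + 4 * w\<^sup>2 + 2 * z * w + 2 * y * w"

definition gram_Q19_2 :: "int list list" where
  "gram_Q19_2 = [[1, 0, 0, 0],
                 [0, 2, 0, 1],
                 [0, 0, 3, 1],
                 [0, 1, 1, 4]]"

lemma Q19_2_eq_gram:
  "Q19_2 x y z w = (\<Sum>i<4. \<Sum>j<4. [x, y, z, w] ! i * gram_Q19_2 ! i ! j * [x, y, z, w] ! j)"
  by (simp add: Q19_2_def gram_Q19_2_def numeral_eq_Suc power2_eq_square algebra_simps)

end

(*
  Completing squares gives 6 Q = 2 (3z + w)^2 + 3 (2y + w)^2 + 6 x^2 + 19 w^2.  Taking w = 1, or w = 2
  if n = 3 (mod 4), primitivity is automatic, and up to finitely many n it remains to represent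
  m = 6n - 19 w^2 by 2 X^2 + 3 Y^2 + 6 Z^2, the adjoint of X^2 + 2 Y^2 + 3 Z^2.  So one needs a positive
  ternary form of determinant 6 containing a binary section of determinant m: by reduction theory
  there are three classes of such forms, and m = 2 (mod 3) excludes all but the right one.

  The section has a leading coefficient q such that -m is a square modulo q and q lies in the genus of -6
  modulo m.  To find q without Dirichlet's theorem on primes, let psi be the character of -m and
  f = 1 * psi, which is nonnegative and, up to squares, supported on the q for which -m is a square.
  The sum of f(q) / sqrt q diverges because of the squares, whereas twisted by a genus character c it stays
  bounded by the hyperbola method, as long as c and c psi are both nonprincipal.
*)

theory Submission
  imports Defs "HOL-Number_Theory.Number_Theory" "HOL-Analysis.Summation_Tests"
begin

section \<open>Real characters and the hyperbola method\<close>

text \<open>The twists that do not stay bounded decide which m can be reached. If c is principal, or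
  agrees with \<psi> on the units, then c = 1 on the support of f, so its sum is nonnegative. This
  does no harm if the wanted class a satisfies \<psi>(a) = 1, since such terms then enter with a
  positive sign. So the arithmetic input is a class a that is -6 modulo the odd part k of m and has
  \<psi>(a) = 1. Its residue modulo 8 is free and can usually adjust the sign. The exception is m =
  k = 3 (mod 4): there \<psi> is the Jacobi symbol modulo k alone, and the condition becomes (-6/k)
  = 1. Given m = 2 (mod 3), it holds for m = 11 (mod 24) and fails for m = 23 (mod 24). As 6n - 19 =
  23 (mod 24) exactly when n = 3 (mod 4), those n take w = 2, which makes m twice an odd number. The
  number found by the sums need not be prime; it suffices that -m is a square modulo each of its
  prime factors.\<close>

definition real_char :: "nat \<Rightarrow> (nat \<Rightarrow> real) \<Rightarrow> bool" where
  "real_char N c \<longleftrightarrow> (\<forall>a b. c (a * b) = c a * c b) \<and> (\<forall>a. c (a mod N) = c a) \<and>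
     (\<forall>a. if coprime a N then c a = 1 \<or> c a = -1 else c a = 0)"

lemma real_char_mult: "real_char N c \<Longrightarrow> c (a * b) = c a * c b"
  and real_char_mod: "real_char N c \<Longrightarrow> c (a mod N) = c a"
  and real_char_coprime: "real_char N c \<Longrightarrow> coprime a N \<Longrightarrow> c a = 1 \<or> c a = -1"
  and real_char_not_coprime: "real_char N c \<Longrightarrow> \<not> coprime a N \<Longrightarrow> c a = 0"
  unfolding real_char_def by presburger+

lemma real_char_one: "real_char N c \<Longrightarrow> c 1 = 1"
  using real_char_mult[of N c 1 1] real_char_coprime[of N c 1] by auto

lemma real_char_square: "real_char N c \<Longrightarrow> coprime a N \<Longrightarrow> c a * c a = 1"
  using real_char_coprime[of N c a] by auto

lemma real_char_power: "real_char N c \<Longrightarrow> c (a ^ j) = c a ^ j"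
  by (induction j) (simp_all add: real_char_one[simplified] real_char_mult)

lemma real_char_abs_le: "real_char N c \<Longrightarrow> \<bar>c a\<bar> \<le> 1"
  using real_char_coprime[of N c a] real_char_not_coprime[of N c a] by fastforce

lemma real_char_principal: "real_char N (\<lambda>a. of_bool (coprime a N))"
  unfolding real_char_def
proof (intro conjI allI)
  fix a b
  show "of_bool (coprime (a * b) N) = (of_bool (coprime a N) * of_bool (coprime b N) :: real)"
    by (simp add: coprime_mult_left_iff)
  show "of_bool (coprime (a mod N) N) = (of_bool (coprime a N) :: real)"
    by (cases "N = 0") simp_all
qed auto

lemma real_char_times:
  assumes "real_char N c" "real_char N d"
  shows "real_char N (\<lambda>a. c a * d a)"
  unfolding real_char_def
proof (intro conjI allI)
  fix a
  show "if coprime a N then c a * d a = 1 \<or> c a * d a = - 1 else c a * d a = 0"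
    using real_char_coprime[OF assms(1), of a] real_char_coprime[OF assms(2), of a]
      real_char_not_coprime[OF assms(1), of a] by auto
qed (simp_all add: real_char_mult[OF assms(1)] real_char_mult[OF assms(2)]
      real_char_mod[OF assms(1)] real_char_mod[OF assms(2)])

text \<open>The coprimality factor turns the empty product into the principal character, so that
  every subset of a family, the empty one included, yields a character.\<close>

lemma real_char_prod:
  assumes "finite S" "\<And>i. i \<in> S \<Longrightarrow> real_char N (c i)"
  shows "real_char N (\<lambda>a. of_bool (coprime a N) * (\<Prod>i\<in>S. c i a))"
  using assms
proof (induction S rule: finite_induct)
  case empty
  then show ?case by (simp add: real_char_principal)
next
  case (insert i S)
  then have "real_char N (\<lambda>a. c i a * (of_bool (coprime a N) * (\<Prod>i\<in>S. c i a)))"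
    using real_char_times[of N "c i"] by blast
  also have "(\<lambda>a. c i a * (of_bool (coprime a N) * (\<Prod>i\<in>S. c i a))) =
      (\<lambda>a. of_bool (coprime a N) * (\<Prod>i\<in>insert i S. c i a))"
    using insert.hyps by (simp add: fun_eq_iff)
  finally show ?case .
qed

section \<open>Partial sums of nonprincipal real characters\<close>

lemma real_char_period_sum:
  assumes "real_char N c" "N > 0" "c a = -1"
  shows "(\<Sum>n<N. c n) = 0"
proof -
  let ?g = "\<lambda>n. (a * n) mod N"
  have cop: "coprime a N"
    using assms(3) real_char_not_coprime[OF assms(1), of a] by linarith
  have inj: "inj_on ?g {..<N}"
  proof (rule inj_onI)
    fix x y assume "x \<in> {..<N}" "y \<in> {..<N}" "?g x = ?g y"
    then have "[a * x = a * y] (mod N)" "x < N" "y < N" by (auto simp: cong_def)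
    then have "[x = y] (mod N)" using cong_mult_lcancel_nat[OF cop] by simp
    then show "x = y" using \<open>x < N\<close> \<open>y < N\<close> by (simp add: cong_def)
  qed
  have img: "?g ` {..<N} = {..<N}"
    using assms(2) by (intro endo_inj_surj inj) auto
  \<comment> \<open>Multiplication by \<open>a\<close> permutes the residues and negates the
    sum.\<close>
  have "(\<Sum>n<N. c n) = (\<Sum>n<N. c (?g n))"
    using sum.reindex[OF inj, of c] unfolding img comp_def .
  also have "\<dots> = (\<Sum>n<N. c a * c n)"
    by (simp add: real_char_mod[OF assms(1)] real_char_mult[OF assms(1)])
  also have "\<dots> = - (\<Sum>n<N. c n)"
    using assms(3) by (simp add: sum_negf)
  finally show ?thesis by simp
qed

text \<open>Nonprincipality is given by a witness with \<open>c a = -1\<close>. Full periods then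
  cancel, leaving fewer than \<open>N\<close> terms of absolute value at most 1.\<close>

lemma real_char_partial_sum:
  assumes "real_char N c" "N > 0" "c a = -1"
  shows "\<bar>\<Sum>n<x. c n\<bar> \<le> N"
proof (induction x rule: less_induct)
  case (less x)
  show ?case
  proof (cases "x < N")
    case True
    have "\<bar>\<Sum>n<x. c n\<bar> \<le> (\<Sum>n<x. \<bar>c n\<bar>)" by (rule sum_abs)
    also have "\<dots> \<le> (\<Sum>n<x. 1)" by (intro sum_mono real_char_abs_le[OF assms(1)])
    also have "\<dots> \<le> N" using True by simp
    finally show ?thesis .
  next
    case False
    then have x: "x = (x - N) + N" by simp
    have per: "c (n + N) = c n" for n
      using real_char_mod[OF assms(1), of "n + N"] real_char_mod[OF assms(1), of n] by simp
    have "(\<Sum>n<x. c n) = (\<Sum>n<N. c n) + (\<Sum>n\<in>{N..<x}. c n)"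
      using False by (metis atLeast0LessThan le_cases not_le sum.atLeastLessThan_concat zero_le)
    also have "(\<Sum>n\<in>{N..<x}. c n) = (\<Sum>n<x - N. c (n + N))"
      using x sum.shift_bounds_nat_ivl[of c 0 N "x - N"] by (simp add: atLeast0LessThan)
    finally have "(\<Sum>n<x. c n) = (\<Sum>n<x - N. c n)"
      by (simp add: per real_char_period_sum[OF assms])
    then show ?thesis using less[of "x - N"] False assms(2) by simp
  qed
qed

lemma summation_by_parts_bound:
  fixes c w :: "nat \<Rightarrow> real"
  assumes "\<And>v. \<bar>\<Sum>n\<in>{u<..v}. c n\<bar> \<le> K"
    and "\<And>n. n > u \<Longrightarrow> w (Suc n) \<le> w n" "\<And>n. n > u \<Longrightarrow> w n \<ge> 0" "K \<ge> 0"
  shows "\<bar>\<Sum>n\<in>{u<..v}. c n * w n\<bar> \<le> K * w (Suc u)"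
proof (cases "u \<le> v")
  case True
  let ?D = "\<lambda>v. \<Sum>n\<in>{u<..v}. c n"
  \<comment> \<open>Abel summation: with the boundary term subtracted, the bound telescopes and the
    induction closes.\<close>
  have "\<bar>(\<Sum>n\<in>{u<..v}. c n * w n) - ?D v * w (Suc v)\<bar> \<le> K * (w (Suc u) - w (Suc v))"
    using True
  proof (induction v rule: dec_induct)
    case base
    then show ?case by simp
  next
    case (step v)
    have ins: "{u<..Suc v} = insert (Suc v) {u<..v}" using step.hyps by auto
    have "(\<Sum>n\<in>{u<..Suc v}. c n * w n) - ?D (Suc v) * w (Suc (Suc v)) =
      ((\<Sum>n\<in>{u<..v}. c n * w n) - ?D v * w (Suc v)) +
      ?D (Suc v) * (w (Suc v) - w (Suc (Suc v)))"
      by (simp add: ins algebra_simps)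
    moreover have "\<bar>?D (Suc v) * (w (Suc v) - w (Suc (Suc v)))\<bar> \<le> K * (w (Suc v) - w (Suc (Suc v)))"
      using assms(1)[of "Suc v"] assms(2)[of "Suc v"] step.hyps
      by (simp add: abs_mult mult_right_mono)
    ultimately show ?case using step.IH by (simp add: algebra_simps abs_le_iff)
  qed
  moreover have "\<bar>?D v * w (Suc v)\<bar> \<le> K * w (Suc v)"
    using assms(1)[of v] assms(3)[of "Suc v"] True by (simp add: abs_mult mult_right_mono)
  ultimately show ?thesis unfolding right_diff_distrib by linarith
next
  case False
  then show ?thesis using assms(3)[of "Suc u"] assms(4) by simp
qed

lemma real_char_weighted_sum:
  assumes "real_char N c" "N > 0" "c a = -1"
  shows "\<bar>\<Sum>n\<in>{u<..v}. c n / sqrt n\<bar> \<le> 2 * N / sqrt (real (Suc u))"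
proof -
  \<comment> \<open>A segment is the difference of two initial sums, hence the factor 2.\<close>
  have "\<bar>\<Sum>n\<in>{u<..v}. c n\<bar> \<le> 2 * N" for v
  proof (cases "u \<le> v")
    case True
    have "{..<Suc v} = {..<Suc u} \<union> {u<..v}" using True by auto
    then have "(\<Sum>n<Suc v. c n) = (\<Sum>n<Suc u. c n) + (\<Sum>n\<in>{u<..v}. c n)"
      by (metis (no_types, lifting) sum.union_disjoint finite_lessThan finite_greaterThanAtMost
          disjoint_iff greaterThanAtMost_iff lessThan_iff not_less_eq)
    then show ?thesis
      using real_char_partial_sum[OF assms, of "Suc v"] real_char_partial_sum[OF assms, of "Suc u"]
      by linarith
  qed simp
  then have "\<bar>\<Sum>n\<in>{u<..v}. c n * (1 / sqrt n)\<bar> \<le> 2 * N * (1 / sqrt (real (Suc u)))"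
    by (intro summation_by_parts_bound) (auto simp: frac_le)
  then show ?thesis by simp
qed

lemma sum_inverse_sqrt_le: "(\<Sum>j\<in>{0<..y}. 1 / sqrt (real j)) \<le> 2 * sqrt (real y)"
proof (induction y)
  case (Suc y)
  let ?a = "sqrt (real (Suc y))" and ?b = "sqrt (real y)"
  have a: "?a > 0" "?b \<ge> 0" "?a * ?a = real y + 1" "?b * ?b = real y" by auto
  have sq: "(a - b) * (a - b) = (2 * a - 2 * b) * a - (a * a - b * b)" for a b :: real
    by (simp add: algebra_simps)
  \<comment> \<open>As a^2 - b^2 = 1, this says 1 <= 2a(a - b), which makes the estimate
    telescope.\<close>
  have "0 \<le> (?a - ?b) * (?a - ?b)" by simp
  then have "1 \<le> (2 * ?a - 2 * ?b) * ?a" unfolding sq a(3,4) by simp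
  then have "1 / ?a \<le> 2 * ?a - 2 * ?b" using a(1) by (simp add: divide_le_eq)
  moreover have "{0<..Suc y} = insert (Suc y) {0<..y}" by auto
  ultimately show ?case using Suc.IH by simp
qed simp

section \<open>Dirichlet's hyperbola method\<close>

definition hyperbola :: "nat \<Rightarrow> (nat \<times> nat) set" where
  "hyperbola y = {(i, j). 0 < i \<and> 0 < j \<and> i * j \<le> y\<^sup>2}"

text \<open>The cutoff is a square so that the region splits at the integer \<open>y\<close>. For i
  <= y the inner sum is a full sum minus a tail: the full sums contribute K^2 and the tails K. For i
  > y the inner sums are tails already and contribute 2K.\<close>

lemma hyperbola_sum_bound:
  fixes \<alpha> \<beta> :: "nat \<Rightarrow> real"
  assumes "\<And>i. \<bar>\<alpha> i\<bar> \<le> 1 / sqrt i" "\<And>i. \<bar>\<beta> i\<bar> \<le> 1 / sqrt i"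
    and \<alpha>: "\<And>u v. \<bar>\<Sum>i\<in>{u<..v}. \<alpha> i\<bar> \<le> K / sqrt (real (Suc u))"
    and \<beta>: "\<And>u v. \<bar>\<Sum>i\<in>{u<..v}. \<beta> i\<bar> \<le> K / sqrt (real (Suc u))"
    and "y > 0" "K \<ge> 0"
  shows "\<bar>\<Sum>(i, j)\<in>hyperbola y. \<alpha> i * \<beta> j\<bar> \<le> K\<^sup>2 + 3 * K"
proof -
  let ?P1 = "SIGMA i:{0<..y}. {0<..y\<^sup>2 div i}"
  \<comment> \<open>The coordinates are swapped here, so that the outer variable is again at most
    \<open>y\<close>.\<close>
  let ?P2 = "SIGMA j:{0<..y}. {y<..y\<^sup>2 div j}"
  have le_iff: "i * j \<le> y\<^sup>2 \<longleftrightarrow> j \<le> y\<^sup>2 div i" if "i > 0" for i j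
    using that by (simp add: less_eq_div_iff_mult_less_eq mult.commute)
  have big: "j \<le> y" if "y < i" "i * j \<le> y\<^sup>2" for i j
  proof (rule ccontr)
    assume "\<not> j \<le> y"
    then have "y * y < i * j" using that by (intro mult_strict_mono) auto
    then show False using that by (simp add: power2_eq_square)
  qed
  have split: "hyperbola y = ?P1 \<union> prod.swap ` ?P2"
  proof (intro equalityI subsetI)
    fix x assume "x \<in> hyperbola y"
    then obtain i j where x: "x = (i, j)" "0 < i" "0 < j" "i * j \<le> y\<^sup>2"
      by (auto simp: hyperbola_def)
    show "x \<in> ?P1 \<union> prod.swap ` ?P2"
    proof (cases "i \<le> y")
      case True
      then show ?thesis using x le_iff[of i j] by auto
    next
      case False
      then have "(j, i) \<in> ?P2" using x big[of i j] le_iff[of j i] by (auto simp: mult.commute)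
      then show ?thesis using x by (metis UnCI image_eqI swap_simp)
    qed
  next
    fix x assume "x \<in> ?P1 \<union> prod.swap ` ?P2"
    then consider i j where "x = (i, j)" "0 < i" "0 < j" "j \<le> y\<^sup>2 div i"
      | i j where "x = (i, j)" "0 < j" "y < i" "i \<le> y\<^sup>2 div j"
      by auto
    then show "x \<in> hyperbola y"
    proof cases
      case 1
      then show ?thesis using le_iff[of i j] by (simp add: hyperbola_def)
    next
      case 2
      then show ?thesis using le_iff[of j i] by (simp add: hyperbola_def mult.commute)
    qed
  qed
  have disj: "?P1 \<inter> prod.swap ` ?P2 = {}" by auto
  have "(\<Sum>(i, j)\<in>hyperbola y. \<alpha> i * \<beta> j) =
      (\<Sum>(i, j)\<in>?P1. \<alpha> i * \<beta> j) + (\<Sum>(i, j)\<in>prod.swap ` ?P2. \<alpha> i * \<beta> j)"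
    unfolding split by (intro sum.union_disjoint disj) auto
  also have "(\<Sum>(i, j)\<in>prod.swap ` ?P2. \<alpha> i * \<beta> j) = (\<Sum>(j, i)\<in>?P2. \<beta> j * \<alpha> i)"
    by (subst sum.reindex) (auto simp: inj_on_def case_prod_unfold mult.commute)
  finally have eq: "(\<Sum>(i, j)\<in>hyperbola y. \<alpha> i * \<beta> j) =
      (\<Sum>i\<in>{0<..y}. \<alpha> i * (\<Sum>j\<in>{0<..y\<^sup>2 div i}. \<beta> j)) +
      (\<Sum>j\<in>{0<..y}. \<beta> j * (\<Sum>i\<in>{y<..y\<^sup>2 div j}. \<alpha> i))"
    by (simp add: sum.Sigma[symmetric] sum_distrib_left)
  let ?T = "\<lambda>i. \<Sum>j\<in>{y\<^sup>2 div i<..y\<^sup>2}. \<beta> j"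
  have B: "(\<Sum>j\<in>{0<..y\<^sup>2 div i}. \<beta> j) = (\<Sum>j\<in>{0<..y\<^sup>2}. \<beta> j) - ?T i" for i
  proof -
    have "{0<..y\<^sup>2} = {0<..y\<^sup>2 div i} \<union> {y\<^sup>2 div i<..y\<^sup>2}"
      using order.trans[OF _ div_le_dividend[of "y\<^sup>2" i]] by auto
    then have "(\<Sum>j\<in>{0<..y\<^sup>2}. \<beta> j) = (\<Sum>j\<in>{0<..y\<^sup>2 div i}. \<beta> j) + ?T i"
      by (metis (no_types, lifting) sum.union_disjoint finite_greaterThanAtMost
          disjoint_iff greaterThanAtMost_iff not_le)
    then show ?thesis by simp
  qed
  have tail: "\<bar>\<alpha> i * ?T i\<bar> \<le> K / y" if "i \<in> {0<..y}" for i
  proof -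
    have i: "i > 0" using that by simp
    \<comment> \<open>The first index of the tail times \<open>i\<close> is at least y^2. The bounds
      for \<open>\<alpha> i\<close> and for the tail therefore multiply to at most
      \<open>K / y\<close>, and \<open>y\<close> such terms add up to \<open>K\<close>.\<close>
    have "y\<^sup>2 \<le> i * Suc (y\<^sup>2 div i)"
      using i dividend_less_times_div[of i "y\<^sup>2"] by simp
    then have "(real y)\<^sup>2 \<le> real i * real (Suc (y\<^sup>2 div i))"
      by (metis of_nat_le_iff of_nat_mult of_nat_power)
    then have "real y \<le> sqrt (real i * real (Suc (y\<^sup>2 div i)))"
      using real_le_rsqrt by blast
    then have y: "real y \<le> sqrt i * sqrt (real (Suc (y\<^sup>2 div i)))"
      by (simp only: real_sqrt_mult)
    have "\<bar>\<alpha> i * ?T i\<bar> \<le> 1 / sqrt i * (K / sqrt (real (Suc (y\<^sup>2 div i))))"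
      unfolding abs_mult by (intro mult_mono assms) auto
    also have "\<dots> = K / (sqrt i * sqrt (real (Suc (y\<^sup>2 div i))))" by simp
    also have "\<dots> \<le> K / y" using y \<open>y > 0\<close> \<open>K \<ge> 0\<close> by (intro frac_le) auto
    finally show ?thesis .
  qed
  have sum1: "\<bar>\<Sum>i\<in>{0<..y}. \<alpha> i * (\<Sum>j\<in>{0<..y\<^sup>2 div i}. \<beta> j)\<bar> \<le> K\<^sup>2 + K"
  proof -
    have "(\<Sum>i\<in>{0<..y}. \<alpha> i * (\<Sum>j\<in>{0<..y\<^sup>2 div i}. \<beta> j)) =
        (\<Sum>i\<in>{0<..y}. \<alpha> i) * (\<Sum>j\<in>{0<..y\<^sup>2}. \<beta> j) - (\<Sum>i\<in>{0<..y}. \<alpha> i * ?T i)"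
      by (simp add: B right_diff_distrib sum_subtractf sum_distrib_right)
    moreover have "\<bar>(\<Sum>i\<in>{0<..y}. \<alpha> i) * (\<Sum>j\<in>{0<..y\<^sup>2}. \<beta> j)\<bar> \<le> K * K"
      unfolding abs_mult using \<alpha>[of 0 y] \<beta>[of 0 "y\<^sup>2"] \<open>K \<ge> 0\<close>
      by (intro mult_mono) auto
    moreover have "\<bar>\<Sum>i\<in>{0<..y}. \<alpha> i * ?T i\<bar> \<le> (\<Sum>i\<in>{0<..y}. K / y)"
      using tail by (intro order.trans[OF sum_abs] sum_mono) auto
    moreover have "(\<Sum>i\<in>{0<..y}. K / y) = K" using \<open>y > 0\<close> by simp
    ultimately show ?thesis unfolding power2_eq_square by linarith
  qed
  have sum2: "\<bar>\<Sum>j\<in>{0<..y}. \<beta> j * (\<Sum>i\<in>{y<..y\<^sup>2 div j}. \<alpha> i)\<bar> \<le> 2 * K"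
  proof -
    have "\<bar>\<Sum>j\<in>{0<..y}. \<beta> j * (\<Sum>i\<in>{y<..y\<^sup>2 div j}. \<alpha> i)\<bar> \<le>
        (\<Sum>j\<in>{0<..y}. 1 / sqrt j * (K / sqrt (real (Suc y))))"
      by (intro order.trans[OF sum_abs] sum_mono) (unfold abs_mult, intro mult_mono assms, auto)
    also have "\<dots> = (\<Sum>j\<in>{0<..y}. 1 / sqrt j) * (K / sqrt (real (Suc y)))"
      by (simp only: sum_distrib_right)
    also have "\<dots> \<le> 2 * sqrt y * (K / sqrt (real (Suc y)))"
      using \<open>K \<ge> 0\<close> by (intro mult_right_mono sum_inverse_sqrt_le) auto
    also have "\<dots> = 2 * K * (sqrt y / sqrt (real (Suc y)))" by simp
    also have "\<dots> \<le> 2 * K * 1" using \<open>K \<ge> 0\<close> by (intro mult_left_mono) auto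
    finally show ?thesis by simp
  qed
  show ?thesis using sum1 sum2 unfolding eq by linarith
qed

section \<open>The convolution of 1 and a real character: the coefficients of zeta(s) L(s,
  \<psi>)\<close>

definition divisor_sum :: "(nat \<Rightarrow> real) \<Rightarrow> nat \<Rightarrow> real" where
  "divisor_sum \<psi> q = (\<Sum>d | d dvd q. \<psi> d)"

text \<open>Raising the exponent to j + 1 adds exactly the divisors l^(j+1) d with d dividing r,
  which contribute one more term of the geometric sum.\<close>

lemma divisor_sum_prime_power:
  assumes "real_char N \<psi>" "prime l" "\<not> l dvd r" "r > 0"
  shows "divisor_sum \<psi> (l ^ j * r) = (\<Sum>i\<le>j. \<psi> l ^ i) * divisor_sum \<psi> r"
proof (induction j)
  case 0
  then show ?case by simp
next
  case (Suc j)
  have l: "l > 0" using assms(2) prime_gt_0_nat by blast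
  have "{d. d dvd l ^ Suc j * r} = {d. d dvd l ^ j * r} \<union> (\<lambda>d. l ^ Suc j * d) ` {d. d dvd r}"
  proof (intro equalityI subsetI)
    fix d assume "d \<in> {d. d dvd l ^ Suc j * r}"
    then obtain a b where d: "d = a * b" "a dvd l ^ Suc j" "b dvd r"
      using division_decomp[of d "l ^ Suc j" r] by auto
    obtain i where i: "i \<le> Suc j" "a = l ^ i"
      using d(2) divides_primepow_nat[OF assms(2)] by blast
    show "d \<in> {d. d dvd l ^ j * r} \<union> (\<lambda>d. l ^ Suc j * d) ` {d. d dvd r}"
    proof (cases "i = Suc j")
      case False
      then have "a dvd l ^ j" using i by (simp add: le_imp_power_dvd)
      then show ?thesis using d by (simp add: mult_dvd_mono)
    qed (use d i in auto)
  next
    fix d assume "d \<in> {d. d dvd l ^ j * r} \<union> (\<lambda>d. l ^ Suc j * d) ` {d. d dvd r}"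
    then show "d \<in> {d. d dvd l ^ Suc j * r}"
      by (auto simp: mult.assoc intro: dvd_mult mult_dvd_mono)
  qed
  moreover have "{d. d dvd l ^ j * r} \<inter> (\<lambda>d. l ^ Suc j * d) ` {d. d dvd r} = {}"
  proof (rule ccontr)
    assume "\<not> ?thesis"
    then obtain d where "l ^ Suc j * d dvd l ^ j * r" by blast
    then have "l ^ j * (l * d) dvd l ^ j * r" by (simp add: mult_ac)
    then have "l * d dvd r" using l by (simp add: nat_mult_dvd_cancel_disj)
    then show False using assms(3) dvd_mult_left by blast
  qed
  moreover have "inj_on (\<lambda>d. l ^ Suc j * d) {d. d dvd r}"
    using l by (auto intro!: inj_onI)
  ultimately have "divisor_sum \<psi> (l ^ Suc j * r) =
      divisor_sum \<psi> (l ^ j * r) + (\<Sum>d | d dvd r. \<psi> (l ^ Suc j * d))"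
    unfolding divisor_sum_def using l assms(4)
    by (simp add: sum.union_disjoint sum.reindex)
  also have "(\<Sum>d | d dvd r. \<psi> (l ^ Suc j * d)) = \<psi> l ^ Suc j * divisor_sum \<psi> r"
    unfolding divisor_sum_def real_char_mult[OF assms(1)] real_char_power[OF assms(1)]
    by (simp only: sum_distrib_left)
  finally show ?case using Suc.IH by (simp add: algebra_simps)
qed

lemma geometric_sum_sign:
  fixes x :: real
  assumes "x = 1 \<or> x = -1"
  shows "(\<Sum>i\<le>j. x ^ i) = (if x = 1 then j + 1 else of_bool (even j))"
proof (cases "x = 1")
  case False
  then have "x = -1" using assms by simp
  then show ?thesis by (induction j) auto
qed simp

lemma prime_power_decomp_nat:
  assumes "q > 1"
  obtains l j r :: nat where "prime l" "q = l ^ j * r" "\<not> l dvd r" "j > 0" "r > 0" "r < q"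
proof -
  obtain l where l: "prime l" "l dvd q" using assms prime_factor_nat[of q] by auto
  then obtain r where r: "q = l ^ multiplicity l q * r" "\<not> l dvd r"
    using multiplicity_decompose'[of q l] assms not_prime_unit[of l] by (metis not_one_less_zero)
  have j: "multiplicity l q > 0"
    using l r(2) r(1) by (metis mult_1 neq0_conv power_0)
  have "r > 0" using r(2) by (metis dvd_0_right gr0I)
  moreover have "1 < l ^ multiplicity l q"
    using one_less_power[OF prime_gt_1_nat[OF l(1)] j] .
  then have "r < q" using \<open>r > 0\<close> r(1)
    by (metis mult_1 nat_mult_less_cancel1 mult.commute)
  ultimately show ?thesis using that l r j by blast
qed

text \<open>A prime with \<open>\<psi> l = -1\<close> contributes the factor 1 or 0 according to the
  parity of its exponent. A nonzero value thus forces these exponents to be even, and these primes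
  are collected in \<open>s\<close>.\<close>

lemma divisor_sum_real_char:
  assumes "real_char N \<psi>"
  shows "q > 0 \<Longrightarrow> coprime q N \<Longrightarrow> divisor_sum \<psi> q \<ge> 0 \<and>
     (divisor_sum \<psi> q \<noteq> 0 \<longrightarrow>
        (\<exists>s r. q = s\<^sup>2 * r \<and> (\<forall>l. prime l \<longrightarrow> l dvd r \<longrightarrow> \<psi> l = 1)))"
proof (induction q rule: less_induct)
  case (less q)
  show ?case
  proof (cases "q > 1")
    case False
    then have "q = 1" using less by simp
    then show ?thesis
      using real_char_one[OF assms] by (auto simp: divisor_sum_def intro!: exI[of _ 1])
  next
    case True
    obtain l j r where q: "prime l" "q = l ^ j * r" "\<not> l dvd r" "j > 0" "r > 0" "r < q"
      using prime_power_decomp_nat[OF True] .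
    have cop: "coprime l N" "coprime r N" using less.prems q by auto
    note IH = less.IH[OF \<open>r < q\<close> \<open>r > 0\<close> cop(2)]
    have sgn: "\<psi> l = 1 \<or> \<psi> l = -1" using real_char_coprime[OF assms cop(1)] .
    have eq: "divisor_sum \<psi> q = (if \<psi> l = 1 then j + 1 else of_bool (even j)) * divisor_sum \<psi> r"
      unfolding q(2) divisor_sum_prime_power[OF assms q(1,3,5)] geometric_sum_sign[OF sgn] ..
    have nonneg: "divisor_sum \<psi> q \<ge> 0" using eq IH by simp
    have "\<exists>s r. q = s\<^sup>2 * r \<and> (\<forall>l. prime l \<longrightarrow> l dvd r \<longrightarrow> \<psi> l = 1)"
      if nz: "divisor_sum \<psi> q \<noteq> 0"
    proof -
      have "divisor_sum \<psi> r \<noteq> 0" using nz eq by auto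
      then obtain s t where st: "r = s\<^sup>2 * t" "\<And>l. prime l \<Longrightarrow> l dvd t \<Longrightarrow> \<psi> l = 1"
        using IH by blast
      show ?thesis
      proof (cases "\<psi> l = 1")
        case True
        have "\<psi> l' = 1" if "prime l'" "l' dvd l ^ j * t" for l'
        proof (cases "l' dvd t")
          case False
          then have "l' dvd l" using that prime_dvd_mult_iff prime_dvd_power by blast
          then show ?thesis using that(1) q(1) True primes_dvd_imp_eq by blast
        qed (use st that in blast)
        moreover have "q = s\<^sup>2 * (l ^ j * t)" using q(2) st(1) by simp
        ultimately show ?thesis by blast
      next
        case False
        then have "even j" using nz eq by (auto split: if_splits)
        then obtain i where "j = 2 * i" by blast
        then have "q = (l ^ i * s)\<^sup>2 * t"
          using q(2) st(1) by (simp add: power_mult_distrib power_mult[symmetric] mult.commute)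
        then show ?thesis using st(2) by blast
      qed
    qed
    then show ?thesis using nonneg by blast
  qed
qed

text \<open>All exponents of a square are even, so no local factor vanishes and each is at least
  1.\<close>

lemma divisor_sum_square:
  assumes "real_char N \<psi>"
  shows "s > 0 \<Longrightarrow> coprime s N \<Longrightarrow> divisor_sum \<psi> (s\<^sup>2) \<ge> 1"
proof (induction s rule: less_induct)
  case (less s)
  show ?case
  proof (cases "s > 1")
    case False
    then have "s = 1" using less by simp
    then show ?thesis
      using real_char_one[OF assms] by (auto simp: divisor_sum_def)
  next
    case True
    obtain l j r where s: "prime l" "s = l ^ j * r" "\<not> l dvd r" "j > 0" "r > 0" "r < s"
      using prime_power_decomp_nat[OF True] .
    have cop: "coprime l N" "coprime r N" using less.prems s by auto
    note IH = less.IH[OF \<open>r < s\<close> \<open>r > 0\<close> cop(2)]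
    have sgn: "\<psi> l = 1 \<or> \<psi> l = -1" using real_char_coprime[OF assms cop(1)] .
    have nd: "\<not> l dvd r\<^sup>2" "r\<^sup>2 > 0" using s prime_dvd_power by auto
    have "s\<^sup>2 = l ^ (2 * j) * r\<^sup>2"
      using s(2) by (simp add: power_mult_distrib power_mult[symmetric] mult.commute)
    then have "divisor_sum \<psi> (s\<^sup>2) = (if \<psi> l = 1 then real (2 * j + 1) else 1) * divisor_sum \<psi> (r\<^sup>2)"
      by (simp add: divisor_sum_prime_power[OF assms s(1) nd] geometric_sum_sign[OF sgn])
    moreover have "1 * 1 \<le> (if \<psi> l = 1 then real (2 * j + 1) else 1) * divisor_sum \<psi> (r\<^sup>2)"
      using IH by (intro mult_mono) auto
    ultimately show ?thesis by simp
  qed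
qed

lemma real_char_eq_1:
  assumes "real_char N \<psi>" "r > 0" "\<And>l. prime l \<Longrightarrow> l dvd r \<Longrightarrow> \<psi> l = 1"
  shows "\<psi> r = 1"
  using assms(2,3)
proof (induction r rule: prime_divisors_induct)
  case (unit x)
  then show ?case using real_char_one[OF assms(1)] by simp
next
  case (factor p x)
  then show ?case by (simp add: real_char_mult[OF assms(1)])
qed simp

lemma divisor_sum_convolution:
  assumes "real_char N c" 
  shows "(\<Sum>q\<in>{0<..y\<^sup>2}. c q * divisor_sum \<psi> q / sqrt q) =
     (\<Sum>(i, j)\<in>hyperbola y. (c i / sqrt i) * (c j * \<psi> j / sqrt j))"
proof -
  have "(\<Sum>q\<in>{0<..y\<^sup>2}. c q * divisor_sum \<psi> q / sqrt q) =
      (\<Sum>q\<in>{0<..y\<^sup>2}. \<Sum>d | d dvd q. c q * \<psi> d / sqrt q)"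
    by (simp add: divisor_sum_def sum_distrib_left sum_divide_distrib)
  also have "\<dots> = (\<Sum>(q, d)\<in>(SIGMA q:{0<..y\<^sup>2}. {d. d dvd q}). c q * \<psi> d / sqrt q)"
    by (intro sum.Sigma) auto
  also have "\<dots> = (\<Sum>(i, j)\<in>hyperbola y. (c i / sqrt i) * (c j * \<psi> j / sqrt j))"
    by (rule sum.reindex_bij_witness[of _ "\<lambda>(i, j). (i * j, j)" "\<lambda>(q, d). (q div d, d)"])
      (auto simp: hyperbola_def real_char_mult[OF assms] real_sqrt_mult mult_ac elim!: dvdE)
  finally show ?thesis .
qed

lemma real_char_divisor_sum_bounded:
  assumes "real_char N c" "real_char N \<psi>" "N > 0" "c a = -1" "c b * \<psi> b = -1" "y > 0"
  shows "\<bar>\<Sum>q\<in>{0<..y\<^sup>2}. c q * divisor_sum \<psi> q / sqrt q\<bar> \<le> (2 * real N)\<^sup>2 + 3 * (2 * real N)"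
proof -
  note c\<psi> = real_char_times[OF assms(1,2)]
  show ?thesis
    unfolding divisor_sum_convolution[OF assms(1)]
    using real_char_abs_le[OF assms(1)] real_char_abs_le[OF c\<psi>] assms(6)
      real_char_weighted_sum[OF assms(1,3,4)] real_char_weighted_sum[OF c\<psi> assms(3,5)]
    by (intro hyperbola_sum_bound) (simp_all add: divide_right_mono)
qed

section \<open>Divergence of the untwisted sum, and numbers in a prescribed genus\<close>

lemma sum_inverse_coprime_unbounded:
  assumes "N > 0"
  obtains y :: nat where "y > 0" "(\<Sum>s\<in>{0<..y}. of_bool (coprime s N) / real s) > B"
proof -
  have "\<exists>n. B * N < (\<Sum>i<n. 1 / real (Suc i))"
  proof (rule ccontr)
    assume "\<not> ?thesis"
    then have "summable (\<lambda>i. 1 / real (Suc i))"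
      by (intro summableI_nonneg_bounded[of _ "B * N"]) (auto simp: not_less)
    then have "summable (\<lambda>i. inverse (real i))"
      by (subst summable_Suc_iff[symmetric]) (simp add: inverse_eq_divide)
    then show False using not_summable_harmonic by blast
  qed
  then obtain n where n: "(\<Sum>i<n. 1 / real (Suc i)) > B * N" by blast
  let ?y = "Suc (n * N)"
  have "B < (\<Sum>i<n. 1 / real (Suc i)) / N" using n assms by (simp add: less_divide_eq)
  also have "\<dots> = (\<Sum>i<n. 1 / real (Suc i * N))" by (simp add: sum_divide_distrib algebra_simps)
  also have "\<dots> \<le> (\<Sum>i<n. of_bool (coprime (Suc (i * N)) N) / real (Suc (i * N)))"
  proof (intro sum_mono)
    fix i
    \<comment> \<open>The numbers 1 + iN are coprime to N and at most (i + 1)N, so the sum dominates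
      1/N times the harmonic sum.\<close>
    have "coprime (Suc (i * N)) N"
      by (metis coprime_Suc_left_nat coprime_mult_right_iff coprime_commute)
    moreover have "Suc (i * N) \<le> Suc i * N" using assms by simp
    then have "real (Suc (i * N)) \<le> real (Suc i * N)" using of_nat_le_iff by blast
    ultimately show "1 / real (Suc i * N) \<le> of_bool (coprime (Suc (i * N)) N) / real (Suc (i * N))"
      using frac_le[of 1 1 "real (Suc (i * N))" "real (Suc i * N)"] by (simp add: add_pos_nonneg)
  qed
  also have "\<dots> = (\<Sum>s\<in>(\<lambda>i. Suc (i * N)) ` {..<n}. of_bool (coprime s N) / real s)"
    using assms by (subst sum.reindex) (auto simp: inj_on_def)
  also have "\<dots> \<le> (\<Sum>s\<in>{0<..?y}. of_bool (coprime s N) / real s)"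
    by (intro sum_mono2) (auto simp: mult_le_mono1)
  finally show ?thesis using that[of ?y] by simp
qed

text \<open>The terms q = s^2 suffice: the weight 1 / sqrt q is just heavy enough to turn them into
  a harmonic sum, and all other terms are nonnegative.\<close>

lemma divisor_sum_unbounded:
  assumes "real_char N \<psi>" "N > 0"
  obtains y :: nat where "y > 0"
    "(\<Sum>q\<in>{0<..y\<^sup>2}. of_bool (coprime q N) * divisor_sum \<psi> q / sqrt q) > B"
proof -
  obtain y where y: "y > 0" "(\<Sum>s\<in>{0<..y}. of_bool (coprime s N) / real s) > B"
    using sum_inverse_coprime_unbounded[OF assms(2)] .
  note y(2)
  also have "(\<Sum>s\<in>{0<..y}. of_bool (coprime s N) / real s) \<le>
      (\<Sum>s\<in>{0<..y}. of_bool (coprime (s\<^sup>2) N) * divisor_sum \<psi> (s\<^sup>2) / sqrt (real (s\<^sup>2)))"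
    using divisor_sum_square[OF assms(1)] by (intro sum_mono) (auto simp: divide_right_mono)
  also have "\<dots> = (\<Sum>q\<in>(\<lambda>s. s\<^sup>2) ` {0<..y}. of_bool (coprime q N) * divisor_sum \<psi> q / sqrt q)"
    by (subst sum.reindex) (auto simp: inj_on_def)
  also have "\<dots> \<le> (\<Sum>q\<in>{0<..y\<^sup>2}. of_bool (coprime q N) * divisor_sum \<psi> q / sqrt q)"
    using divisor_sum_real_char[OF assms(1)] by (intro sum_mono2) (auto simp: power_mono)
  finally show ?thesis using that y(1) by blast
qed

text \<open>The product of \<open>1 + c i a * c i q\<close> over \<open>I\<close> vanishes unless q
  agrees with a under every character. If there were no \<open>r\<close>, it would vanish wherever f
  does not. Expanding it over the subsets of \<open>I\<close> gives a sum equal to zero, in which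
  the empty subset is unbounded while every other term is bounded below.\<close>

theorem exists_genus_representative:
  assumes "real_char N \<psi>" "N > 0" "finite I" "\<And>i. i \<in> I \<Longrightarrow> real_char N (c i)"
    and a: "coprime a N" "\<psi> a = 1"
  obtains r where "r > 0" "coprime r N" "\<And>l. prime l \<Longrightarrow> l dvd r \<Longrightarrow> \<psi> l = 1"
    "\<And>i. i \<in> I \<Longrightarrow> c i r = c i a"
proof (rule ccontr)
  assume contr: "\<not> thesis"
  note found = that and \<psi> = assms(1) and c = assms(4)
  define f where "f q = of_bool (coprime q N) * divisor_sum \<psi> q / sqrt q" for q :: nat
  define C where "C S q = of_bool (coprime q N) * (\<Prod>i\<in>S. c i q)" for S q
  define G where "G S y = (\<Sum>q\<in>{0<..y\<^sup>2}. C S q * divisor_sum \<psi> q / sqrt q)" for S and y :: nat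
  define K where "K = (2 * real N)\<^sup>2 + 3 * (2 * real N)"
  have C: "real_char N (C S)" if "S \<subseteq> I" for S
    unfolding C_def using that assms(3,4) finite_subset by (intro real_char_prod) auto
  have split: "\<exists>s r. q = s\<^sup>2 * r \<and> (\<forall>l. prime l \<longrightarrow> l dvd r \<longrightarrow> \<psi> l = 1)"
    if "f q \<noteq> 0" "q > 0" for q
    using that divisor_sum_real_char[OF \<psi>, of q] by (auto simp: f_def)
  have sq: "real_char N d \<Longrightarrow> coprime (s\<^sup>2 * r) N \<Longrightarrow> d (s\<^sup>2 * r) = d r" for d s r
    using real_char_square[of N d s] by (simp add: real_char_mult power2_eq_square)
  have f_nonneg: "f q \<ge> 0" if "q > 0" for q
    using divisor_sum_real_char[OF \<psi>, of q] that by (auto simp: f_def)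
  have f_zero: "f q * (\<Prod>i\<in>I. 1 + c i a * c i q) = 0" if q: "q > 0" for q
  proof (rule ccontr)
    assume "\<not> ?thesis"
    then have nz: "f q \<noteq> 0" "\<And>i. i \<in> I \<Longrightarrow> 1 + c i a * c i q \<noteq> 0"
      using assms(3) by auto
    have cop: "coprime q N" using nz(1) by (auto simp: f_def)
    obtain s r where sr: "q = s\<^sup>2 * r" "\<And>l. prime l \<Longrightarrow> l dvd r \<Longrightarrow> \<psi> l = 1"
      using split[OF nz(1) q] by blast
    have "c i r = c i a" if "i \<in> I" for i
    proof -
      have "c i q = c i r" using sq[OF c[OF that]] cop sr(1) by simp
      then show ?thesis
        using nz(2)[OF that] real_char_coprime[OF c[OF that] cop]
          real_char_coprime[OF c[OF that] a(1)] by auto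
    qed
    moreover have "r > 0" "coprime r N" using q sr(1) cop by auto
    ultimately show False using contr sr(2) found[of r] by blast
  qed
  have zero: "(\<Sum>S\<in>Pow I. C S a * G S y) = 0" for y
  proof -
    have "0 = (\<Sum>q\<in>{0<..y\<^sup>2}. f q * (\<Prod>i\<in>I. c i a * c i q + 1))"
      using f_zero by (intro sum.neutral[symmetric]) (auto simp: add.commute)
    also have "\<dots> = (\<Sum>q\<in>{0<..y\<^sup>2}. \<Sum>S\<in>Pow I. C S a * (C S q * divisor_sum \<psi> q / sqrt q))"
      using a(1) by (simp add: prod_add[OF assms(3)] f_def C_def sum_distrib_left prod.distrib mult_ac)
    also have "\<dots> = (\<Sum>S\<in>Pow I. C S a * G S y)"
      by (subst sum.swap) (simp add: G_def sum_distrib_left)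
    finally show ?thesis by simp
  qed
  \<comment> \<open>A one-sided bound is enough, since large positive terms only help; this absorbs
    the exceptional characters.\<close>
  have lower: "C S a * G S y \<ge> - K" if S: "S \<subseteq> I" and y: "y > 0" for S y
  proof -
    note CS = C[OF S]
    have nonneg: "C S a * G S y \<ge> 0" if "C S a = 1" "\<And>q. q > 0 \<Longrightarrow> f q \<noteq> 0 \<Longrightarrow> C S q = 1"
    proof -
      have "C S q * divisor_sum \<psi> q / sqrt q \<ge> 0" if q: "q > 0" for q
      proof (cases "f q = 0")
        case True
        then show ?thesis using q by (auto simp: f_def C_def)
      next
        case False
        then have "C S q = 1" using that q \<open>\<And>q. q > 0 \<Longrightarrow> f q \<noteq> 0 \<Longrightarrow> C S q = 1\<close> by blast
        moreover have "coprime q N" using False by (auto simp: f_def)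
        ultimately show ?thesis using f_nonneg[OF q] by (simp add: f_def)
      qed
      then show ?thesis unfolding that(1) G_def by (auto intro: sum_nonneg)
    qed
    have "K \<ge> 0" by (simp add: K_def)
    \<comment> \<open>Either \<open>C S\<close> is principal, or it agrees with
      \<open>\<psi>\<close> on the units, or both twists are nonprincipal and the hyperbola bound
      applies.\<close>
    consider "\<And>q. coprime q N \<Longrightarrow> C S q = 1" | "\<And>q. coprime q N \<Longrightarrow> C S q * \<psi> q = 1"
      | u v where "C S u = -1" "C S v * \<psi> v = -1"
      using real_char_coprime[OF CS] real_char_coprime[OF real_char_times[OF CS \<psi>]] by metis
    then show ?thesis
    proof cases
      case 1
      then have "C S a * G S y \<ge> 0" using a(1) by (intro nonneg) (auto simp: f_def)
      then show ?thesis using \<open>K \<ge> 0\<close> by linarith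
    next
      case 2
      \<comment> \<open>On the support of f, \<open>q\<close> is a square times primes with
        \<open>\<psi> l = 1\<close>, so that \<open>\<psi> q = 1\<close>. The hypothesis
        \<open>\<psi> a = 1\<close> then gives the term the right sign.\<close>
      have "C S q = 1" if q: "q > 0" "f q \<noteq> 0" for q
      proof -
        obtain s r where sr: "q = s\<^sup>2 * r" "\<And>l. prime l \<Longrightarrow> l dvd r \<Longrightarrow> \<psi> l = 1"
          using split[OF q(2,1)] by blast
        have cop: "coprime q N" using q by (auto simp: f_def)
        have "\<psi> r = 1" using real_char_eq_1[OF \<psi> _ sr(2)] q(1) sr(1) by simp
        then have "\<psi> q = 1" using sq[OF \<psi>] cop sr(1) by simp
        then show ?thesis using 2[OF cop] by simp
      qed
      moreover have "C S a = 1" using 2[OF a(1)] a(2) by simp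
      ultimately have "C S a * G S y \<ge> 0" using nonneg by blast
      then show ?thesis using \<open>K \<ge> 0\<close> by linarith
    next
      case 3
      have "\<bar>G S y\<bar> \<le> K"
        unfolding G_def K_def
        using real_char_divisor_sum_bounded[OF CS \<psi> assms(2) 3 y] .
      moreover have "C S a = 1 \<or> C S a = -1" using real_char_coprime[OF CS a(1)] .
      ultimately show ?thesis by auto
    qed
  qed
  \<comment> \<open>Chosen so that the empty subset outweighs the bounds \<open>- K\<close> of all
    the others.\<close>
  obtain y where y: "y > 0"
    "(\<Sum>q\<in>{0<..y\<^sup>2}. of_bool (coprime q N) * divisor_sum \<psi> q / sqrt q) > card (Pow I) * K"
    using divisor_sum_unbounded[OF \<psi> assms(2)] .
  have G0: "C {} a * G {} y > card (Pow I) * K"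
    using y(2) a(1) by (simp add: G_def C_def)
  have "(\<Sum>S\<in>Pow I. C S a * G S y) = C {} a * G {} y + (\<Sum>S\<in>Pow I - {{}}. C S a * G S y)"
    using assms(3) by (intro sum.remove) auto
  moreover have "(\<Sum>S\<in>Pow I - {{}}. C S a * G S y) \<ge> (\<Sum>S\<in>Pow I - {{}}. - K)"
    using lower y(1) by (intro sum_mono) auto
  moreover have "(\<Sum>S\<in>Pow I - {{}}. - K) \<ge> - (card (Pow I) * K)"
  proof -
    have "real (card (Pow I - {{}})) * K \<le> real (card (Pow I)) * K"
      using assms(3) by (intro mult_right_mono of_nat_mono card_mono) (auto simp: K_def)
    then show ?thesis by simp
  qed
  ultimately show False using zero[of y] G0 by linarith
qed

section \<open>Legendre and Jacobi symbols\<close>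

lemma Legendre_cong: "[a = b] (mod p) \<Longrightarrow> Legendre a p = Legendre b p"
  by (simp add: Legendre_def QuadRes_def cong_def)

lemma Legendre_eq_0_iff: "Legendre a p = 0 \<longleftrightarrow> p dvd a"
  by (simp add: Legendre_def cong_0_iff)

lemma Legendre_values: "Legendre a p = 0 \<or> Legendre a p = 1 \<or> Legendre a p = -1"
  by (simp add: Legendre_def)

text \<open>Euler's criterion yields only congruences; values in {-1, 0, 1} differ by at most 2, so
  congruence modulo \<open>p > 2\<close> makes them equal.\<close>

lemma cong_sign_imp_eq:
  fixes x y :: int
  assumes "[x = y] (mod p)" "p > 2" "\<bar>x\<bar> \<le> 1" "\<bar>y\<bar> \<le> 1"
  shows "x = y"
proof -
  have "p dvd x - y" using assms(1) by (simp add: cong_iff_dvd_diff)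
  moreover have "\<bar>x - y\<bar> < p" using assms by linarith
  ultimately have "x - y = 0" using zdvd_imp_le[of p "\<bar>x - y\<bar>"] by fastforce
  then show ?thesis by simp
qed

lemma Legendre_mult:
  assumes "prime p" "p > 2"
  shows "Legendre (a * b) (int p) = Legendre a p * Legendre b p"
proof (rule cong_sign_imp_eq)
  let ?e = "(p - 1) div 2"
  have "[Legendre (a * b) p = a ^ ?e * b ^ ?e] (mod p)"
    using euler_criterion[OF assms, of "a * b"] by (simp add: power_mult_distrib)
  moreover have "[Legendre a p * Legendre b p = a ^ ?e * b ^ ?e] (mod p)"
    using assms by (intro cong_mult euler_criterion)
  ultimately show "[Legendre (a * b) p = Legendre a p * Legendre b p] (mod int p)"
    by (meson cong_sym cong_trans)
  show "\<bar>Legendre a p * Legendre b p\<bar> \<le> 1"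
    using Legendre_values[of a p] Legendre_values[of b p] by auto
qed (use assms Legendre_values[of "a * b" p] in auto)

lemma Legendre_1: "p > 2 \<Longrightarrow> Legendre 1 p = 1"
proof -
  assume "p > 2"
  then have "\<not> p dvd 1" using zdvd_imp_le[of p 1] by auto
  moreover have "QuadRes p 1" unfolding QuadRes_def by (rule exI[of _ 1]) simp
  ultimately show ?thesis by (simp add: Legendre_def cong_0_iff)
qed

lemma Legendre_minus_1:
  assumes "prime p" "p > 2"
  shows "Legendre (-1) (int p) = (if p mod 4 = 1 then 1 else -1)"
proof -
  have "odd p" using assms prime_odd_nat by blast
  have "Legendre (-1) p = (-1) ^ ((p - 1) div 2)"
    using assms Legendre_values[of "-1" p] euler_criterion[OF assms, of "-1"]
    by (intro cong_sign_imp_eq[of _ _ p]) (auto simp: power_abs)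
  also have "\<dots> = (if p mod 4 = 1 then 1 else -1)"
  proof -
    have "p mod 4 = 1 \<and> even ((p - 1) div 2) \<or> p mod 4 = 3 \<and> odd ((p - 1) div 2)"
      using \<open>odd p\<close> by presburger
    then show ?thesis by auto
  qed
  finally show ?thesis .
qed

lemma Legendre_2:
  assumes "prime p" "p > 2"
  shows "Legendre 2 (int p) = (if p mod 8 = 1 \<or> p mod 8 = 7 then 1 else -1)"
proof -
  have "\<not> int p dvd 2" using assms zdvd_imp_le[of "int p" 2] by auto
  then interpret GAUSS p 2
    using assms by unfold_locales (auto simp: cong_0_iff)
  define h where "h = (int p - 1) div 2"
  have h: "int p = 2 * h + 1" using p_eq2 by (simp add: h_def)
  \<comment> \<open>The doubles of 1, ..., h lie below p = 2h + 1, so reduction changes nothing, and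
    the set \<open>E\<close> of Gauss's lemma consists of those exceeding h.\<close>
  have "(\<lambda>x. x mod int p) ` (\<lambda>x. x * 2) ` {0<..h} = (\<lambda>x. 2 * x) ` {0<..h}"
    unfolding image_image using h by (intro image_cong) auto
  then have "E = (\<lambda>x. 2 * x) ` {h div 2<..h}"
    unfolding E_def C_def B_def A_def h_def[symmetric] using h by auto
  then have "card E = nat (h - h div 2)"
    by (simp add: card_image inj_on_def)
  then have "Legendre 2 p = (-1) ^ nat (h - h div 2)"
    using gauss_lemma by simp
  moreover have "even (nat (h - h div 2)) \<longleftrightarrow> p mod 8 = 1 \<or> p mod 8 = 7"
  proof -
    have "h \<ge> 0" using h by linarith
    then obtain j where j: "h = int j" using nonneg_int_cases by blast
    have "p = 2 * j + 1" using h j by linarith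
    moreover have "nat (h - h div 2) = j - j div 2" using j by (simp add: nat_diff_distrib' flip: of_nat_div)
    moreover have "even (j - j div 2) \<longleftrightarrow> j mod 4 = 0 \<or> j mod 4 = 3" by presburger
    moreover have "(2 * j + 1) mod 8 = 1 \<longleftrightarrow> j mod 4 = 0" "(2 * j + 1) mod 8 = 7 \<longleftrightarrow> j mod 4 = 3"
      by presburger+
    ultimately show ?thesis by simp
  qed
  ultimately show ?thesis by simp
qed

text \<open>The moduli 3, 4, 8 and 12 divide 24, so identities between the symbols reduce to checks
  on these eight units.\<close>

lemma mod_24_cases:
  fixes n :: nat
  assumes "odd n" "\<not> 3 dvd n"
  shows "n mod 24 \<in> {1, 5, 7, 11, 13, 17, 19, 23}"
proof -
  have "odd (n mod 24)" "\<not> 3 dvd n mod 24" using assms by (simp_all add: dvd_mod_iff)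
  moreover have "\<forall>r\<in>{..<24::nat}. odd r \<longrightarrow> \<not> 3 dvd r \<longrightarrow> r \<in> {1, 5, 7, 11, 13, 17, 19, 23}"
    by (simp add: lessThan_nat_numeral lessThan_Suc)
  ultimately show ?thesis by simp
qed

lemma Legendre_3:
  assumes "prime p" "p > 3"
  shows "Legendre 3 (int p) = (if p mod 12 = 1 \<or> p mod 12 = 11 then 1 else -1)"
proof -
  have odd: "odd p" using assms prime_odd_nat[of p] by auto
  have n3: "\<not> 3 dvd p" using assms primes_dvd_imp_eq[of 3 p] by auto
  have A: "Legendre p 3 = (if p mod 3 = 1 then 1 else -1)"
  proof (cases "p mod 3 = 1")
    case True
    then have "[int p = 1] (mod 3)" by (simp add: cong_def) presburger
    then show ?thesis using True Legendre_cong[of p 1 3] Legendre_1[of 3] by simp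
  next
    case False
    then have "p mod 3 = 2" using n3 by presburger
    then have "[int p = -1] (mod 3)" by (simp add: cong_def) presburger
    then show ?thesis using False Legendre_cong[of p "-1" 3] Legendre_minus_1[of 3] by simp
  qed
  have B: "Legendre 3 p * Legendre p 3 = (-1) ^ ((p - 1) div 2)"
    using Quadratic_Reciprocity[of 3 p] assms by simp
  have C: "even ((p - 1) div 2) \<longleftrightarrow> p mod 4 = 1" using odd by presburger
  have D: "p mod 12 = 1 \<or> p mod 12 = 11 \<longleftrightarrow> (p mod 3 = 1 \<longleftrightarrow> p mod 4 = 1)"
  proof -
    have mods: "p mod 24 mod 3 = p mod 3" "p mod 24 mod 4 = p mod 4" "p mod 24 mod 12 = p mod 12"
      by (simp_all add: mod_mod_cancel)
    have "r mod 12 = 1 \<or> r mod 12 = 11 \<longleftrightarrow> (r mod 3 = 1 \<longleftrightarrow> r mod 4 = 1)"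
      if "r \<in> {1, 5, 7, 11, 13, 17, 19, 23}" for r :: nat using that by auto
    from this[OF mod_24_cases[OF odd n3]] show ?thesis unfolding mods .
  qed
  have "x = (if P \<longleftrightarrow> Q then 1 else -1)"
    if "x * (if P then 1 else -1) = (if Q then 1 else -1)" for x :: int and P Q
    using that by (cases P; cases Q) simp_all
  from this[OF B[unfolded A minus_one_power_iff C]] show ?thesis unfolding D .
qed

text \<open>The residues 1, 5, 7, 11 form the kernel of the character of discriminant -24, hence the
  single inequality.\<close>

lemma Legendre_minus_6:
  assumes "prime p" "p > 3"
  shows "Legendre (-6) (int p) = (if p mod 24 < 12 then 1 else -1)"
proof -
  have odd: "odd p" using assms prime_odd_nat[of p] by auto
  have n3: "\<not> 3 dvd p" using assms primes_dvd_imp_eq[of 3 p] by auto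
  have "Legendre (-6) p = Legendre (-1) p * Legendre 2 p * Legendre 3 p"
    using Legendre_mult[OF assms(1), of "-1" 2] Legendre_mult[OF assms(1), of "-2" 3] assms by simp
  then have L: "Legendre (-6) p = (if p mod 4 = 1 then 1 else -1) *
      (if p mod 8 = 1 \<or> p mod 8 = 7 then 1 else -1) * (if p mod 12 = 1 \<or> p mod 12 = 11 then 1 else -1)"
    using assms by (simp only: Legendre_minus_1 Legendre_2 Legendre_3)
  have mods: "p mod 24 mod 4 = p mod 4" "p mod 24 mod 8 = p mod 8" "p mod 24 mod 12 = p mod 12"
    by (simp_all add: mod_mod_cancel)
  have "(if r mod 4 = 1 then 1 else -1) * (if r mod 8 = 1 \<or> r mod 8 = 7 then 1 else -1) *
      (if r mod 12 = 1 \<or> r mod 12 = 11 then 1 else -1) = (if r < 12 then 1 else -1 :: int)"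
    if "r \<in> {1, 5, 7, 11, 13, 17, 19, 23}" for r :: nat using that by auto
  from this[OF mod_24_cases[OF odd n3]] show ?thesis unfolding L mods .
qed

section \<open>The Jacobi symbol and reciprocity\<close>

definition jacobi :: "int \<Rightarrow> nat \<Rightarrow> int" where
  "jacobi a k = (\<Prod>p\<in>#prime_factorization k. Legendre a (int p))"

lemma jacobi_1: "jacobi a 1 = 1"
  by (simp add: jacobi_def)

lemma jacobi_prime_mult: "prime p \<Longrightarrow> k > 0 \<Longrightarrow> jacobi a (p * k) = Legendre a p * jacobi a k"
  by (simp add: jacobi_def prime_factorization_mult prime_factorization_prime)

lemma odd_nat_induct [consumes 2, case_names one prime_mult]:
  fixes k :: nat
  assumes "k > 0" "odd k" "P 1"
    "\<And>p k. prime p \<Longrightarrow> p > 2 \<Longrightarrow> k > 0 \<Longrightarrow> odd k \<Longrightarrow> P k \<Longrightarrow> P (p * k)"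
  shows "P k"
  using assms(1,2)
proof (induction k rule: prime_divisors_induct)
  case (factor p k)
  then have "p > 2" using prime_ge_2_nat[of p] by (cases "p = 2") auto
  then show ?case using factor assms(4) by auto
qed (use assms(3) in auto)

lemma jacobi_mult:
  assumes "k > 0" "odd k"
  shows "jacobi (a * b) k = jacobi a k * jacobi b k"
  using assms by (induction k rule: odd_nat_induct)
    (simp_all add: jacobi_1[simplified] jacobi_prime_mult Legendre_mult)

lemma jacobi_cong:
  assumes "k > 0" "[a = b] (mod int k)"
  shows "jacobi a k = jacobi b k"
  using assms
proof (induction k rule: prime_divisors_induct)
  case (factor p k)
  then have "[a = b] (mod int p)" "[a = b] (mod int k)" "k > 0"
    using cong_dvd_modulus[of a b "int (p * k)"] by auto
  then show ?case using factor Legendre_cong by (simp add: jacobi_prime_mult)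
qed (simp_all add: jacobi_def)

lemma jacobi_coprime:
  assumes "k > 0" "coprime a (int k)"
  shows "jacobi a k = 1 \<or> jacobi a k = -1"
  using assms
proof (induction k rule: prime_divisors_induct)
  case (factor p k)
  have "\<not> int p dvd a"
    using factor.prems(2) factor.hyps(1) coprime_common_divisor[of a "int (p * k)" "int p"] by auto
  then have "Legendre a p = 1 \<or> Legendre a p = -1"
    using Legendre_values[of a p] Legendre_eq_0_iff[of a p] by auto
  moreover have "jacobi a k = 1 \<or> jacobi a k = -1" using factor by auto
  ultimately show ?case using factor by (auto simp: jacobi_prime_mult)
qed (simp_all add: jacobi_def)

lemma jacobi_minus_6:
  assumes "k > 0" "odd k" "\<not> 3 dvd k"
  shows "jacobi (-6) k = (if k mod 24 < 12 then 1 else -1)"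
  using assms
proof (induction k rule: odd_nat_induct)
  case (prime_mult p k)
  then have "\<not> 3 dvd p" "\<not> 3 dvd k" by auto
  then have "p > 3" using prime_mult.hyps by (cases "p = 3") auto
  have odd: "odd p" using prime_mult.hyps prime_odd_nat by blast
  have J: "jacobi (-6) (p * k) = (if p mod 24 < 12 then 1 else -1) * (if k mod 24 < 12 then 1 else -1)"
    using prime_mult Legendre_minus_6[OF prime_mult.hyps(1) \<open>p > 3\<close>] \<open>\<not> 3 dvd k\<close>
    by (simp add: jacobi_prime_mult)
  have "(if r < 12 then 1 else -1) * (if s < 12 then 1 else -1) = (if r * s mod 24 < 12 then 1 else -1 :: int)"
    if "r \<in> {1, 5, 7, 11, 13, 17, 19, 23}" "s \<in> {1, 5, 7, 11, 13, 17, 19, 23}" for r s :: nat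
    using that by auto
  from this[OF mod_24_cases[OF odd \<open>\<not> 3 dvd p\<close>] mod_24_cases[OF \<open>odd k\<close> \<open>\<not> 3 dvd k\<close>]]
  show ?case unfolding J mod_mult_eq .
qed (simp add: jacobi_1[simplified])

text \<open>One entry stays prime, because the character of -m is compared with the Legendre symbol
  at primes only. The induction works since both the symbols and the sign are multiplicative in odd
  \<open>k\<close>.\<close>

lemma jacobi_reciprocity:
  assumes "k > 0" "odd k" "prime l" "l > 2" "\<not> l dvd k"
  shows "Legendre (int k) l = (if k mod 4 = 3 \<and> l mod 4 = 3 then -1 else 1) * jacobi (int l) k"
  using assms(1,2,5)
proof (induction k rule: odd_nat_induct)
  case one
  then show ?case using Legendre_1[of "int l"] assms(4) by (simp add: jacobi_1[simplified])
next
  case (prime_mult p k)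
  have nd: "\<not> l dvd p" "\<not> l dvd k" using prime_mult.prems by auto
  have odd: "odd p" "odd l" using prime_mult.hyps assms prime_odd_nat by blast+
  have pl: "p \<noteq> l" using nd by auto
  have "\<not> int p dvd int l" using pl assms(3) prime_mult.hyps(1) primes_dvd_imp_eq by auto
  then have v: "Legendre l p = 1 \<or> Legendre l p = -1"
    using Legendre_values[of l p] Legendre_eq_0_iff[of l p] by auto
  have qr: "Legendre p l * Legendre l p = (-1) ^ ((p - 1) div 2 * ((l - 1) div 2))"
    using Quadratic_Reciprocity prime_mult.hyps assms pl by blast
  have m4: "x mod 4 = 1 \<and> even ((x - 1) div 2) \<or> x mod 4 = 3 \<and> odd ((x - 1) div 2)"
    if "odd x" for x :: nat using that by presburger
  have Lp: "Legendre p l = (if p mod 4 = 3 \<and> l mod 4 = 3 then -1 else 1) * Legendre l p"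
    using m4[OF odd(1)] m4[OF odd(2)] qr v by (auto simp: power_mult)
  have Lk: "Legendre k l = (if k mod 4 = 3 \<and> l mod 4 = 3 then -1 else 1) * jacobi l k"
    using prime_mult.IH[OF nd(2)] .
  have Lpk: "Legendre (p * k) l = Legendre p l * Legendre k l"
    using Legendre_mult[OF assms(3,4)] by simp
  have jpk: "jacobi l (p * k) = Legendre l p * jacobi l k"
    using jacobi_prime_mult[OF prime_mult.hyps(1,3)] .
  have iff: "p * k mod 4 = 3 \<longleftrightarrow> (p mod 4 = 3) \<noteq> (k mod 4 = 3)"
  proof -
    have "r * s mod 4 = 3 \<longleftrightarrow> (r = 3) \<noteq> (s = 3)" if "r = 1 \<or> r = 3" "s = 1 \<or> s = 3" for r s :: nat
      using that by auto
    moreover have "p mod 4 = 1 \<or> p mod 4 = 3" "k mod 4 = 1 \<or> k mod 4 = 3"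
      using m4[OF odd(1)] m4[OF \<open>odd k\<close>] by blast+
    ultimately have "(p mod 4) * (k mod 4) mod 4 = 3 \<longleftrightarrow> (p mod 4 = 3) \<noteq> (k mod 4 = 3)" by blast
    then show ?thesis unfolding mod_mult_eq .
  qed
  show ?case
    unfolding Lpk jpk Lp Lk iff
    by (auto simp only: if_True if_False simp_thms mult_minus_left mult_minus_right mult_1 minus_minus mult.assoc mult.left_commute split: if_splits)
qed

section \<open>Symbols as characters to a common modulus\<close>

lemma real_charI:
  assumes "M dvd N"
    and "\<And>a b. coprime a N \<Longrightarrow> coprime b N \<Longrightarrow> g (a * b) = g a * g b"
    and "\<And>a. coprime a N \<Longrightarrow> g a = 1 \<or> g a = -1"
    and "\<And>a b. [a = b] (mod M) \<Longrightarrow> g a = g b"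
  shows "real_char N (\<lambda>a. if coprime a N then g a else 0)"
  unfolding real_char_def
proof (intro conjI allI)
  fix a
  have "coprime (a mod N) N \<longleftrightarrow> coprime a N" by (cases "N = 0") simp_all
  moreover have "[a mod N = a] (mod M)" using assms(1) by (simp add: cong_def mod_mod_cancel)
  then have "g (a mod N) = g a" by (rule assms(4))
  ultimately show "(if coprime (a mod N) N then g (a mod N) else 0) = (if coprime a N then g a else 0)"
    by simp
qed (use assms(2,3) in auto)

lemma real_char_jacobi:
  assumes "odd k" "k > 0" "k dvd N"
  shows "real_char N (\<lambda>a. if coprime a N then of_int (jacobi (int a) k) else 0)"
proof (rule real_charI[OF assms(3)])
  fix a b :: nat assume "[a = b] (mod k)"
  then show "(of_int (jacobi (int a) k) :: real) = of_int (jacobi (int b) k)"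
    using jacobi_cong[OF assms(2), of "int a" "int b"] by (simp add: cong_int_iff)
next
  fix a assume "coprime a N"
  then have "coprime (int a) (int k)" using assms(3) coprime_divisors[of a a k N] by simp
  then show "(of_int (jacobi (int a) k) :: real) = 1 \<or> of_int (jacobi (int a) k) = (-1 :: real)"
    using jacobi_coprime[OF assms(2)] by (metis of_int_1 of_int_minus)
qed (use assms jacobi_mult in simp)

lemma real_char_Legendre:
  assumes "prime p" "p > 2" "p dvd N"
  shows "real_char N (\<lambda>a. if coprime a N then of_int (Legendre (int a) (int p)) else 0)"
proof -
  have "jacobi a p = Legendre a p" for a
    using jacobi_prime_mult[OF assms(1), of 1 a] by (simp add: jacobi_1[simplified])
  then have "(\<lambda>a. if coprime a N then real_of_int (Legendre (int a) (int p)) else 0) =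
      (\<lambda>a. if coprime a N then real_of_int (jacobi (int a) p) else 0)" by (simp only:)
  then show ?thesis
    using real_char_jacobi[of p N] assms prime_odd_nat[of p] prime_gt_0_nat[of p] by metis
qed

lemma sign_if_mult:
  "(P \<longleftrightarrow> (Q \<longleftrightarrow> R)) \<Longrightarrow>
    (if P then 1 else -1 :: real) = (if Q then 1 else -1) * (if R then 1 else -1)"
  by auto

lemma real_char_mod_4:
  assumes "4 dvd N"
  shows "real_char N (\<lambda>a. if coprime a N then (if a mod 4 = 1 then 1 else -1) else 0)"
proof (rule real_charI[OF assms])
  fix a b :: nat assume "coprime a N" "coprime b N"
  then have "odd a" "odd b" using assms coprime_common_divisor[of _ N 2] by fastforce+
  define r s where rs: "r = a mod 4" "s = b mod 4"
  then have "r = 1 \<or> r = 3" "s = 1 \<or> s = 3" using \<open>odd a\<close> \<open>odd b\<close> by presburger+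
  then have "r * s mod 4 = 1 \<longleftrightarrow> (r = 1 \<longleftrightarrow> s = 1)" by (elim disjE) simp_all
  moreover have "a * b mod 4 = r * s mod 4" unfolding rs by (simp add: mod_mult_eq)
  ultimately have "a * b mod 4 = 1 \<longleftrightarrow> (a mod 4 = 1 \<longleftrightarrow> b mod 4 = 1)" unfolding rs by metis
  then show "(if a * b mod 4 = 1 then 1 else - 1 :: real) =
      (if a mod 4 = 1 then 1 else - 1) * (if b mod 4 = 1 then 1 else - 1)"
    by (rule sign_if_mult)
qed (simp_all only: cong_def, simp_all)

lemma real_char_mod_8:
  assumes "8 dvd N"
  shows "real_char N (\<lambda>a. if coprime a N then (if a mod 8 = 1 \<or> a mod 8 = 7 then 1 else -1) else 0)"
proof (rule real_charI[OF assms])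
  fix a b :: nat assume "coprime a N" "coprime b N"
  then have "odd a" "odd b" using assms coprime_common_divisor[of _ N 2] by fastforce+
  define r s where rs: "r = a mod 8" "s = b mod 8"
  have "n mod 8 = 1 \<or> n mod 8 = 3 \<or> n mod 8 = 5 \<or> n mod 8 = 7" if "odd n" for n :: nat
    using that by presburger
  then have "r = 1 \<or> r = 3 \<or> r = 5 \<or> r = 7" "s = 1 \<or> s = 3 \<or> s = 5 \<or> s = 7"
    unfolding rs using \<open>odd a\<close> \<open>odd b\<close> by blast+
  then have "(r * s mod 8 = 1 \<or> r * s mod 8 = 7) \<longleftrightarrow> ((r = 1 \<or> r = 7) \<longleftrightarrow> (s = 1 \<or> s = 7))"
    by (elim disjE) simp_all
  moreover have "a * b mod 8 = r * s mod 8" unfolding rs by (simp add: mod_mult_eq)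
  ultimately have "(a * b mod 8 = 1 \<or> a * b mod 8 = 7) \<longleftrightarrow>
      ((a mod 8 = 1 \<or> a mod 8 = 7) \<longleftrightarrow> (b mod 8 = 1 \<or> b mod 8 = 7))" unfolding rs by metis
  then show "(if a * b mod 8 = 1 \<or> a * b mod 8 = 7 then 1 else - 1 :: real) =
      (if a mod 8 = 1 \<or> a mod 8 = 7 then 1 else - 1) * (if b mod 8 = 1 \<or> b mod 8 = 7 then 1 else - 1)"
    by (rule sign_if_mult)
qed (simp_all only: cong_def, simp_all)

text \<open>One prime at a time: Chinese remainders if \<open>p\<close> is new, Hensel lifting if it
  already divides \<open>k\<close>.\<close>

lemma square_root_mod_odd:
  fixes a :: int
  assumes "k > 0" "odd k" "coprime a (int k)"
    "\<And>p. prime p \<Longrightarrow> p dvd k \<Longrightarrow> \<exists>x. [x\<^sup>2 = a] (mod int p)"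
  shows "\<exists>x. [x\<^sup>2 = a] (mod int k)"
  using assms
proof (induction k rule: odd_nat_induct)
  case one
  then show ?case by simp
next
  case (prime_mult p k)
  have cop: "coprime a (int p)" "coprime a (int k)" using prime_mult.prems(1) by auto
  obtain x where x: "[x\<^sup>2 = a] (mod int k)" using prime_mult.IH cop prime_mult.prems(2) by auto
  show ?case
  proof (cases "p dvd k")
    case True
    have "\<not> int p dvd x"
    proof
      assume "int p dvd x"
      then have "int p dvd x\<^sup>2" by (simp add: power2_eq_square)
      moreover have "[x\<^sup>2 = a] (mod int p)" using x True by (metis cong_dvd_modulus int_dvd_int_iff)
      ultimately have "int p dvd a" by (simp add: cong_dvd_iff)
      then show False using cop(1) prime_mult.hyps(1) by (metis coprime_common_divisor dvd_refl
            not_prime_unit prime_int_nat_transfer prime_nat_int_transfer)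
    qed
    moreover have "\<not> int p dvd 2" using prime_mult.hyps(2) zdvd_imp_le[of "int p" 2] by auto
    moreover have "prime (int p)" using prime_mult.hyps(1) by simp
    ultimately have "coprime (2 * x) (int p)"
      by (metis coprime_commute prime_dvd_mult_iff prime_imp_coprime)
    then obtain y where y: "[2 * x * y = 1] (mod int p)" using cong_solve_coprime_int by blast
    obtain t where t: "a = x\<^sup>2 + int k * t" using x by (metis cong_iff_lin cong_sym)
    obtain u where u: "2 * x * y = 1 + int p * u" using y by (metis cong_iff_lin cong_sym)
    obtain v where v: "k = p * v" using True by blast
    \<comment> \<open>Newton's step. An inverse \<open>y\<close> of 2x modulo \<open>p\<close>
      suffices: the linear error k t (2xy - 1) gains a factor p, and k^2 is divisible by pk because
      \<open>p\<close> divides \<open>k\<close>.\<close>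
    have "(x + k * (y * t))\<^sup>2 - a = int (p * k) * (u * t + int v * (y * t)\<^sup>2)"
    proof -
      have "(x + k * (y * t))\<^sup>2 - a = int k * (t * (2 * x * y - 1)) + int k * (int k * (y * t)\<^sup>2)"
        unfolding t by (simp add: power2_eq_square algebra_simps)
      also have "2 * x * y - 1 = int p * u" using u by simp
      also have "int k * (int k * (y * t)\<^sup>2) = int k * (int p * int v * (y * t)\<^sup>2)"
        using v by simp
      finally show ?thesis by (simp add: algebra_simps)
    qed
    then show ?thesis by (metis cong_iff_dvd_diff dvd_triv_left)
  next
    case False
    then have "coprime p k" using prime_mult.hyps(1) prime_imp_coprime by blast
    then have pk: "coprime (int p) (int k)" by simp
    obtain y where y: "[y\<^sup>2 = a] (mod int p)"
      using prime_mult.prems(2) prime_mult.hyps(1) by (metis dvd_triv_left)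
    obtain z where z: "[z = y] (mod int p)" "[z = x] (mod int k)"
      using binary_chinese_remainder_int[OF pk] by blast
    have "[z\<^sup>2 = a] (mod int p)" "[z\<^sup>2 = a] (mod int k)"
      using z x y cong_pow cong_trans by blast+
    then have "[z\<^sup>2 = a] (mod int p * int k)" using coprime_cong_mult pk by blast
    then show ?thesis by auto
  qed
qed

section \<open>A Gram matrix of determinant 6 with a prescribed section\<close>

lemma coprime_8_mult_iff: "coprime a (8 * k) \<longleftrightarrow> odd a \<and> coprime a k" for a k :: nat
proof -
  have "8 * k = 2 ^ 3 * k" by simp
  then show ?thesis
    by (simp only: coprime_mult_right_iff coprime_power_right_iff coprime_right_2_iff_odd) simp
qed

text \<open>\<open>\<psi>\<close> is the character of -m, assembled by reciprocity from the Jacobi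
  symbol modulo \<open>k\<close> and characters modulo 4 and 8. The class modulo \<open>k\<close> is
  forced, so only the residue modulo 8 can arrange \<open>\<psi> a = 1\<close>.\<close>

lemma exists_class_with_character_1:
  fixes m :: int and k :: nat
  assumes k: "k > 0" "odd k" "\<not> 3 dvd k"
    and m: "m = k \<and> k mod 4 = 1 \<or> m = k \<and> k mod 24 = 11 \<or> m = 2 * int k"
  obtains \<psi> a where "real_char (8 * k) \<psi>"
    "\<And>l. prime l \<Longrightarrow> coprime l (8 * k) \<Longrightarrow> \<psi> l = of_int (Legendre (- m) (int l))"
    "coprime a (8 * k)" "[int a = -6] (mod int k)" "\<psi> a = 1"
proof -
  define N where "N = 8 * k"
  define J where "J a = (if coprime a N then real_of_int (jacobi (int a) k) else 0)" for a
  define X4 where "X4 a = (if coprime a N then (if a mod 4 = 1 then 1 else -1) else 0 :: real)" for a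
  define X8 where "X8 a = (if coprime a N then (if a mod 8 = 1 \<or> a mod 8 = 7 then 1 else -1) else 0 :: real)" for a
  have J: "real_char N J" unfolding J_def using k by (intro real_char_jacobi) (auto simp: N_def)
  have X4: "real_char N X4" unfolding X4_def by (rule real_char_mod_4) (simp add: N_def)
  have X8: "real_char N X8" unfolding X8_def by (rule real_char_mod_8) (simp add: N_def)
  \<comment> \<open>Chosen so that (-k/l) = E(l) J(l). For k = 3 (mod 4) the sign (-1/l) cancels
    against the sign in reciprocity, and the square of \<open>X4\<close> is the principal
    character.\<close>
  define E where "E = (if k mod 4 = 3 then (\<lambda>a. X4 a * X4 a) else X4)"
  have E: "real_char N E" unfolding E_def using X4 real_char_times[OF X4 X4] by simp
  have k4: "k mod 4 = 1 \<or> k mod 4 = 3" using k(2) by presburger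
  define \<psi> where "\<psi> = (if m = k then (\<lambda>a. E a * J a) else (\<lambda>a. X8 a * (E a * J a)))"
  have \<psi>: "real_char N \<psi>"
    unfolding \<psi>_def using real_char_times[OF E J] real_char_times[OF X8 real_char_times[OF E J]] by simp
  have leg: "\<psi> l = of_int (Legendre (- m) (int l))" if l: "prime l" "coprime l N" for l
  proof -
    have l': "odd l" "coprime l k" using l(2) coprime_8_mult_iff N_def by auto
    have "l > 2" using l(1) l'(1) prime_ge_2_nat[of l] by (cases "l = 2") auto
    have "\<not> l dvd k" using l'(2) l(1) by (metis coprime_absorb_left not_prime_unit)
    have l4: "l mod 4 = 1 \<or> l mod 4 = 3" using l'(1) by presburger
    have "of_int (Legendre (-1) l * Legendre k l) = E l * J l"
      using k4 l4 l(2) unfolding jacobi_reciprocity[OF k(1,2) l(1) \<open>l > 2\<close> \<open>\<not> l dvd k\<close>]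
        Legendre_minus_1[OF l(1) \<open>l > 2\<close>] E_def J_def X4_def by (elim disjE) simp_all
    moreover have "X8 l = of_int (Legendre 2 l)"
      unfolding X8_def Legendre_2[OF l(1) \<open>l > 2\<close>] using l(2) by simp
    moreover have "Legendre (- int k) l = Legendre (-1) l * Legendre k l"
      using Legendre_mult[OF l(1) \<open>l > 2\<close>, of "-1" k] by simp
    moreover have "Legendre (- (2 * int k)) l = Legendre 2 l * Legendre (- int k) l"
      using Legendre_mult[OF l(1) \<open>l > 2\<close>, of 2 "- int k"] by simp
    ultimately show ?thesis using m unfolding \<psi>_def by auto
  qed
  have "coprime 6 (int k)"
  proof -
    have "coprime 2 k" "coprime 3 k" using k prime_imp_coprime[of 3 k] by auto
    then have "coprime (2 * 3) k" by (simp only: coprime_mult_left_iff)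
    then show ?thesis using coprime_int_iff[of 6 k] by simp
  qed
  then have cop6: "coprime (-6) (int k)" by simp
  have residue: "\<exists>a. coprime a N \<and> [int a = -6] (mod int k) \<and> a mod 8 = r" if r: "odd r" "r < 8" for r
  proof -
    have "coprime 8 k" using coprime_8_mult_iff[of k 1] k(2) by (simp add: coprime_commute)
    then obtain a where a: "[a = r] (mod 8)" "[a = nat ((-6) mod int k)] (mod k)"
      using binary_chinese_remainder_nat by blast
    have "[int a = int (nat ((-6) mod int k))] (mod int k)" using a(2) by (simp only: cong_int_iff)
    then have ak: "[int a = -6] (mod int k)" using k(1) by (simp add: cong_def)
    then have "coprime (int a) (int k)" using cop6 cong_imp_coprime cong_sym by blast
    moreover have "a mod 8 = r" using a(1) r(2) by (simp add: cong_def)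
    moreover have "odd a" using \<open>a mod 8 = r\<close> r(1) by presburger
    ultimately show ?thesis using ak unfolding N_def coprime_8_mult_iff by auto
  qed
  have Ja: "J a = of_int (jacobi (-6) k)" if "coprime a N" "[int a = -6] (mod int k)" for a
    using that jacobi_cong[OF k(1)] by (simp add: J_def)
  have jac: "jacobi (-6) k = 1 \<or> jacobi (-6) k = -1"
    using jacobi_coprime[OF k(1)] cop6 by blast
  have mod48: "a mod 4 = (a mod 8) mod 4" for a :: nat by (simp add: mod_mod_cancel)
  have "\<exists>a. coprime a N \<and> [int a = -6] (mod int k) \<and> \<psi> a = 1"
    using m
  proof (elim disjE conjE)
    assume mk: "m = k" "k mod 4 = 1"
    \<comment> \<open>This choice makes \<open>X4 a\<close> equal to (-6/k).\<close>
    define r :: nat where "r = (if jacobi (-6) k = 1 then 1 else 3)"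
    have "odd r" "r < 8" by (simp_all add: r_def)
    then obtain a where "coprime a N" "[int a = -6] (mod int k)" "a mod 8 = r" using residue by blast
    then have a: "coprime a N" "[int a = -6] (mod int k)" "a mod 8 = (if jacobi (-6) k = 1 then 1 else 3)"
      by (simp_all add: r_def)
    have "a mod 4 = (if jacobi (-6) k = 1 then 1 else 3)" using a(3) mod48[of a] by simp
    then have "\<psi> a = 1" using mk jac a(1) Ja[OF a(1,2)] by (auto simp: \<psi>_def E_def X4_def)
    then show ?thesis using a by blast
  next
    assume mk: "m = k" "k mod 24 = 11"
    obtain a where a: "coprime a N" "[int a = -6] (mod int k)" "a mod 8 = 1"
      using residue[of 1] by auto
    \<comment> \<open>No freedom here: \<open>\<psi> a\<close> is (-6/k) for every admissible
      class.\<close>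
    have "jacobi (-6) k = 1" using jacobi_minus_6[OF k] mk(2) by simp
    moreover have "k mod 4 = 3" using mk(2) by presburger
    ultimately have "\<psi> a = 1" using mk a(1) Ja[OF a(1,2)] by (auto simp: \<psi>_def E_def X4_def)
    then show ?thesis using a by blast
  next
    assume mk: "m = 2 * int k"
    \<comment> \<open>Both 1 and 5 are 1 modulo 4, so \<open>E a = 1\<close> for either residue of
      \<open>k\<close> modulo 4, while \<open>X8\<close> separates them.\<close>
    define r :: nat where "r = (if jacobi (-6) k = 1 then 1 else 5)"
    have "odd r" "r < 8" by (simp_all add: r_def)
    then obtain a where "coprime a N" "[int a = -6] (mod int k)" "a mod 8 = r" using residue by blast
    then have a: "coprime a N" "[int a = -6] (mod int k)" "a mod 8 = (if jacobi (-6) k = 1 then 1 else 5)"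
      by (simp_all add: r_def)
    have "a mod 4 = 1" using a(3) mod48[of a] by simp
    then have "E a = 1" using a(1) by (simp add: E_def X4_def)
    moreover have "X8 a = of_int (jacobi (-6) k)" using a(1,3) jac by (auto simp: X8_def)
    ultimately have "\<psi> a = 1" using mk k(1) jac Ja[OF a(1,2)] by (auto simp: \<psi>_def)
    then show ?thesis using a by blast
  qed
  then show ?thesis using that \<psi> leg unfolding N_def by blast
qed

text \<open>These are the entries of the Gram matrix with rows (q, b, 0), (b, c, f), (0, f, g): its
  leading 2x2 minor is m and its determinant is mg - qf^2. Solving for \<open>c\<close> and
  \<open>g\<close> requires that -m is a square modulo q and that qf^2 = -6 modulo m.\<close>

lemma exists_binary_corner:
  fixes m :: int and k :: nat
  assumes k: "k > 0" "odd k" "\<not> 3 dvd k"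
    and m: "m = k \<and> k mod 4 = 1 \<or> m = k \<and> k mod 24 = 11 \<or> m = 2 * int k"
  obtains q b c f g :: int where "q > 0" "q * c - b\<^sup>2 = m" "m * g - q * f\<^sup>2 = 6"
proof -
  obtain \<psi> a where \<psi>: "real_char (8 * k) \<psi>"
    "\<And>l. prime l \<Longrightarrow> coprime l (8 * k) \<Longrightarrow> \<psi> l = of_int (Legendre (- m) (int l))"
    and a: "coprime a (8 * k)" "[int a = -6] (mod int k)" "\<psi> a = 1"
    using exists_class_with_character_1[OF k m] by blast
  have odd_prime: "p > 2" if "prime p" "p dvd k" for p
    using that k(2) prime_ge_2_nat[of p] by (cases "p = 2") auto
  obtain r where r: "r > 0" "coprime r (8 * k)" "\<And>l. prime l \<Longrightarrow> l dvd r \<Longrightarrow> \<psi> l = 1"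
    "\<And>p. p \<in> prime_factors k \<Longrightarrow>
      (if coprime r (8 * k) then real_of_int (Legendre (int r) (int p)) else 0) =
      (if coprime a (8 * k) then real_of_int (Legendre (int a) (int p)) else 0)"
  proof (rule exists_genus_representative[OF \<psi>(1) _ _ _ a(1,3), of "prime_factors k"
        "\<lambda>p a. if coprime a (8 * k) then real_of_int (Legendre (int a) (int p)) else 0"])
    fix p assume "p \<in> prime_factors k"
    then show "real_char (8 * k) (\<lambda>a. if coprime a (8 * k) then real_of_int (Legendre (int a) (int p)) else 0)"
      using odd_prime by (intro real_char_Legendre) (auto simp: in_prime_factors_iff)
  qed (use k(1) in auto)
  have r': "odd r" "coprime r k" using r(2) coprime_8_mult_iff by auto
  have "coprime (int r) (int k)" using r'(2) by simp
  then have rk: "coprime (int k) (int r)" by (simp add: coprime_commute)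
  have "coprime (2 :: int) (int r)" using r'(1) by simp
  then have rm: "coprime (- m) (int r)" using m rk by auto
  have "\<exists>x. [x\<^sup>2 = - m] (mod int r)"
  proof (rule square_root_mod_odd[OF r(1) r'(1) rm])
    fix l assume l: "prime l" "l dvd r"
    then have "coprime l (8 * k)" using r(2) coprime_divisors[of l r "8 * k" "8 * k"] by simp
    then have "Legendre (- m) l = 1" using \<psi>(2)[OF l(1)] r(3)[OF l] by simp
    then have "QuadRes l (- m)" by (auto simp: Legendre_def split: if_splits)
    then show "\<exists>x. [x\<^sup>2 = - m] (mod int l)" by (simp add: QuadRes_def)
  qed
  then obtain b where "[b\<^sup>2 = - m] (mod int r)" by blast
  then have "int r dvd b\<^sup>2 + m" by (simp add: cong_iff_dvd_diff)
  then obtain c where c: "b\<^sup>2 + m = int r * c" by blast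
  have a6: "coprime (-6) (int k)"
  proof -
    have "coprime (int a) (int k)" using a(1) coprime_8_mult_iff by auto
    then show ?thesis using a(2) cong_imp_coprime by blast
  qed
  have "\<exists>x. [x\<^sup>2 = -6 * int r] (mod int k)"
  proof (rule square_root_mod_odd[OF k(1,2)])
    show "coprime (-6 * int r) (int k)" using a6 r'(2) by simp
    fix p assume p: "prime p" "p dvd k"
    then have pk: "p \<in> prime_factors k" using k(1) by (simp add: in_prime_factors_iff)
    have "[int a = -6] (mod int p)" using a(2) p(2) by (meson cong_dvd_modulus int_dvd_int_iff)
    \<comment> \<open>This is what the genus of \<open>r\<close> is for: -6r gets the symbol 1 at
      every prime factor of \<open>k\<close>.\<close>
    then have "Legendre r p = Legendre (-6) p" using r(4)[OF pk] r(2) a(1) Legendre_cong by simp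
    moreover have "\<not> int p dvd -6"
      using a6 p by (metis coprime_common_divisor int_dvd_int_iff not_prime_unit prime_nat_int_transfer)
    ultimately have "Legendre (-6 * r) p = 1"
      using Legendre_mult[OF p(1) odd_prime[OF p], of "-6" r] Legendre_values[of "-6" p] Legendre_eq_0_iff[of "-6" p]
      by auto
    then have "QuadRes p (-6 * r)" by (auto simp: Legendre_def split: if_splits)
    then show "\<exists>x. [x\<^sup>2 = -6 * int r] (mod int p)" by (simp add: QuadRes_def)
  qed
  then obtain x where x: "[x\<^sup>2 = -6 * int r] (mod int k)" by blast
  obtain y where y: "[int r * y = 1] (mod int k)"
    using cong_solve_coprime_int[OF \<open>coprime (int r) (int k)\<close>] by blast
  \<comment> \<open>As \<open>y\<close> inverts \<open>r\<close> and x^2 = -6r, this solves r z^2 =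
    -6 modulo \<open>k\<close>.\<close>
  define z where "z = x * y"
  \<comment> \<open>Adding the odd number \<open>k\<close> changes the parity; an even
    \<open>f\<close> takes care of the factor 2 when m = 2k.\<close>
  define f where "f = (if even z then z else z + int k)"
  have "even f" using k(2) by (simp add: f_def)
  have "[f = z] (mod int k)" by (simp add: f_def cong_def)
  then have "[int r * f\<^sup>2 = int r * z\<^sup>2] (mod int k)" by (intro cong_mult cong_pow cong_refl)
  moreover have "[int r * y\<^sup>2 * x\<^sup>2 = int r * y\<^sup>2 * (-6 * int r)] (mod int k)"
    using x by (intro cong_mult cong_refl)
  moreover have "int r * y\<^sup>2 * x\<^sup>2 = int r * z\<^sup>2" by (simp add: z_def power_mult_distrib)
  moreover have "[-6 * (int r * y)\<^sup>2 = -6 * 1\<^sup>2] (mod int k)"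
    using y by (intro cong_mult cong_pow cong_refl)
  moreover have "-6 * (int r * y)\<^sup>2 = int r * y\<^sup>2 * (-6 * int r)" by (simp add: power2_eq_square)
  ultimately have "[int r * f\<^sup>2 = -6] (mod int k)" by (metis cong_trans mult.right_neutral one_power2)
  then have "int k dvd int r * f\<^sup>2 + 6" by (simp add: cong_iff_dvd_diff)
  moreover have "2 dvd int r * f\<^sup>2 + 6" using \<open>even f\<close> by simp
  moreover have "coprime 2 (int k)" using k(2) by simp
  ultimately have "2 * int k dvd int r * f\<^sup>2 + 6" by (simp add: divides_mult)
  then have "m dvd int r * f\<^sup>2 + 6" using m by (auto intro: dvd_trans)
  then obtain g where "int r * f\<^sup>2 + 6 = m * g" by blast
  then show ?thesis using that[of "int r" c b g f] r(1) c by simp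
qed

section \<open>Ternary forms of determinant 6\<close>

text \<open>The form with parameters \<open>a b c r s t\<close> is \<open>a x\<^sup>2 + b y\<^sup>2 + c z\<^sup>2 + 2 r y z + 2 s x z + 2 t x y\<close>.\<close>

definition adjoint_form :: "int \<Rightarrow> int \<Rightarrow> int \<Rightarrow> int \<Rightarrow> int \<Rightarrow> int \<Rightarrow> int \<Rightarrow> int \<Rightarrow> int \<Rightarrow> int" where
  "adjoint_form a b c r s t x y z =
     (b * c - r\<^sup>2) * x\<^sup>2 + (a * c - s\<^sup>2) * y\<^sup>2 + (a * b - t\<^sup>2) * z\<^sup>2 +
     2 * (s * t - a * r) * y * z + 2 * (r * t - b * s) * x * z + 2 * (r * s - c * t) * x * y"

definition ternary_det :: "int \<Rightarrow> int \<Rightarrow> int \<Rightarrow> int \<Rightarrow> int \<Rightarrow> int \<Rightarrow> int" where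
  "ternary_det a b c r s t = a * b * c + 2 * r * s * t - a * r\<^sup>2 - b * s\<^sup>2 - c * t\<^sup>2"

section \<open>Unimodular substitutions\<close>

lemma adjoint_form_swap_xy: "adjoint_form b a c s r t y x z = adjoint_form a b c r s t x y z"
  and adjoint_form_swap_yz: "adjoint_form a c b r t s x z y = adjoint_form a b c r s t x y z"
  and ternary_det_swap_xy: "ternary_det b a c s r t = ternary_det a b c r s t"
  and ternary_det_swap_yz: "ternary_det a c b r t s = ternary_det a b c r s t"
  by (simp_all add: adjoint_form_def ternary_det_def algebra_simps)

text \<open>The form undergoes the substitution x -> x + ky; its adjoint changes contragrediently,
  which is why \<open>y\<close> moves in the argument.\<close>

lemma adjoint_form_shear_yx:
    "adjoint_form a (b + 2 * k * t + k\<^sup>2 * a) c (r + k * s) s (t + k * a) x (y + k * x) z =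
     adjoint_form a b c r s t x y z"
  and ternary_det_shear_yx:
    "ternary_det a (b + 2 * k * t + k\<^sup>2 * a) c (r + k * s) s (t + k * a) = ternary_det a b c r s t"
  and minor_shear_yx:
    "a * (b + 2 * k * t + k\<^sup>2 * a) - (t + k * a)\<^sup>2 = a * b - t\<^sup>2"
  by (simp_all add: adjoint_form_def ternary_det_def power2_eq_square algebra_simps)

lemma adjoint_form_shear_zx:
    "adjoint_form a b (c + 2 * k * s + k\<^sup>2 * a) (r + k * t) (s + k * a) t x y (z + k * x) =
     adjoint_form a b c r s t x y z"
  and ternary_det_shear_zx:
    "ternary_det a b (c + 2 * k * s + k\<^sup>2 * a) (r + k * t) (s + k * a) t = ternary_det a b c r s t"
  and adjoint_form_shear_zy:
    "adjoint_form a b (c + 2 * k * r + k\<^sup>2 * b) (r + k * b) (s + k * t) t x y (z + k * y) =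
     adjoint_form a b c r s t x y z"
  and ternary_det_shear_zy:
    "ternary_det a b (c + 2 * k * r + k\<^sup>2 * b) (r + k * b) (s + k * t) t = ternary_det a b c r s t"
  by (simp_all add: adjoint_form_def ternary_det_def power2_eq_square algebra_simps)

section \<open>Reduction theory\<close>

lemma nearest_multiple:
  fixes a t :: int
  assumes "a > 0"
  obtains k where "\<bar>2 * (t + k * a)\<bar> \<le> a"
proof -
  \<comment> \<open>\<open>- k\<close> is t/a rounded to a nearest integer.\<close>
  define k where "k = - ((2 * t + a) div (2 * a))"
  have "(2 * t + a) mod (2 * a) = 2 * t + a + 2 * a * k"
    by (simp add: k_def minus_div_mult_eq_mod[symmetric] algebra_simps)
  moreover have "0 \<le> (2 * t + a) mod (2 * a)" "(2 * t + a) mod (2 * a) < 2 * a"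
    using assms by (simp_all add: pos_mod_bound)
  ultimately have "\<bar>2 * (t + k * a)\<bar> \<le> a" by (simp add: algebra_simps abs_le_iff)
  then show ?thesis by (rule that)
qed

text \<open>A 2x2 minor of the adjoint is the determinant times the complementary entry
  \<open>a\<close>. In determinant 6, a section of the adjoint is thus a binary form of determinant
  6a, to which binary reduction applies.\<close>

lemma adjoint_minor_identity:
  "(a * b - t\<^sup>2) * (a * c - s\<^sup>2) - (a * r - s * t)\<^sup>2 = a * ternary_det a b c r s t"
  by (simp add: ternary_det_def power2_eq_square algebra_simps)

lemma square_mod_3: "(x::int)\<^sup>2 mod 3 = 0 \<or> x\<^sup>2 mod 3 = 1"
proof -
  have "x mod 3 = 0 \<or> x mod 3 = 1 \<or> x mod 3 = 2" by presburger
  then have "(x mod 3)\<^sup>2 mod 3 = 0 \<or> (x mod 3)\<^sup>2 mod 3 = 1" by auto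
  then show ?thesis by (simp add: power_mod)
qed

text \<open>The bounds force \<open>a \<le> 2\<close>, leaving the classes of \<open>x\<^sup>2 + y\<^sup>2 + 6 z\<^sup>2\<close>, \<open>x\<^sup>2 + 2 y\<^sup>2 + 3 z\<^sup>2\<close>
  and \<open>2 x\<^sup>2 + 2 y\<^sup>2 + 2 z\<^sup>2 + 2 x y\<close>; the adjoints of the first and the third are squares modulo 3.\<close>

lemma reduced_det_6:
  assumes "a > 0" "a * b - t\<^sup>2 > 0" "ternary_det a b c r s t = 6"
    and red: "\<bar>2 * t\<bar> \<le> a" "\<bar>2 * s\<bar> \<le> a" "a \<le> b"
      "\<bar>2 * (a * r - s * t)\<bar> \<le> a * b - t\<^sup>2" "a * b - t\<^sup>2 \<le> a * c - s\<^sup>2"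
    and m: "adjoint_form a b c r s t x y z = m" "m mod 3 = 2"
  shows "\<exists>x y z. m = 2 * x\<^sup>2 + 3 * y\<^sup>2 + 6 * z\<^sup>2"
proof -
  define G where "G = a * b - t\<^sup>2"
  define H where "H = a * c - s\<^sup>2"
  define u where "u = a * r - s * t"
  have GHu: "G > 0" "G \<le> H" "\<bar>2 * u\<bar> \<le> G" "G * H - u\<^sup>2 = 6 * a"
    using assms(2) red adjoint_minor_identity[of a b t c s r] assms(3)
    by (simp_all add: G_def H_def u_def mult.commute)
  \<comment> \<open>Reducedness of the section of the adjoint gives G^2 <= 8a, that of the section
    of the form gives 3a^2 <= 4G. Together 9a^3 <= 128, which fails from a = 3 on.\<close>
  have sq: "4 * u\<^sup>2 \<le> G\<^sup>2" 
    using power_mono[OF GHu(3), of 2] by (simp add: power_mult_distrib)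
  have "G * G \<le> G * H" using GHu(1,2) by (intro mult_left_mono) auto
  then have GG: "G\<^sup>2 \<le> 8 * a" using GHu(4) sq unfolding power2_eq_square by linarith
  have sqt: "4 * t\<^sup>2 \<le> a\<^sup>2" using power_mono[OF red(1), of 2] by (simp add: power_mult_distrib)
  have "a * a \<le> a * b" using assms(1) red(3) by (intro mult_left_mono) auto
  then have aG: "3 * a\<^sup>2 \<le> 4 * G" using sqt unfolding G_def power2_eq_square right_diff_distrib by linarith
  have "a \<le> 2"
  proof (rule ccontr)
    assume "\<not> a \<le> 2"
    then have a: "a \<ge> 3" by simp
    have "(3 * a\<^sup>2)\<^sup>2 \<le> (4 * G)\<^sup>2" using aG by (intro power_mono) auto
    then have "9 * (a * a * a) * a \<le> 128 * a" using GG by (simp add: power2_eq_square algebra_simps)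
    then have "9 * (a * a * a) \<le> 128" using assms(1) by simp
    moreover have "3 * 3 * 3 \<le> a * a * a" using a by (intro mult_mono) auto
    ultimately show False by linarith
  qed
  then consider "a = 1" | "a = 2" using assms(1) by linarith
  then show ?thesis
  proof cases
    case 1
    then have ts: "t = 0" "s = 0" using red by auto
    have Gb: "G = b" "u = r" "H = c" using 1 ts by (simp_all add: G_def u_def H_def)
    have "b \<le> 2"
    proof (rule ccontr)
      assume "\<not> b \<le> 2"
      then have "3 * 3 \<le> b * b" by (intro mult_mono) auto
      then show False using GG 1 Gb by (simp add: power2_eq_square)
    qed
    then consider "b = 1" | "b = 2" using GHu(1) Gb by linarith
    then show ?thesis
    proof cases
      case b: 1
      then have "r = 0" using GHu(3) Gb by auto
      then have "c = 6" using GHu(4) Gb b 1 by simp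
      then have "m = z\<^sup>2 + 3 * (2 * x\<^sup>2 + 2 * y\<^sup>2)"
        using m(1) 1 b ts \<open>r = 0\<close> by (simp add: adjoint_form_def)
      then have "m mod 3 = z\<^sup>2 mod 3" by (simp only: mod_mult_self2)
      then show ?thesis using m(2) square_mod_3[of z] by simp
    next
      case b: 2
      then have r: "r = -1 \<or> r = 0 \<or> r = 1" using GHu(3) Gb by auto
      have "2 * c - r\<^sup>2 = 6" using GHu(4) Gb b 1 by simp
      then have "r = 0" "c = 3" using r by (auto, presburger+)
      then have "m = 2 * z\<^sup>2 + 3 * y\<^sup>2 + 6 * x\<^sup>2"
        using m(1) 1 b ts by (simp add: adjoint_form_def)
      then show ?thesis by blast
    qed
  next
    case 2
    have "G \<le> 4"
    proof (rule ccontr)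
      assume "\<not> G \<le> 4"
      then have "5 * 5 \<le> G * G" by (intro mult_mono) auto
      then show False using GG 2 by (simp add: power2_eq_square)
    qed
    have t: "t = -1 \<or> t = 0 \<or> t = 1" and s: "s = -1 \<or> s = 0 \<or> s = 1" using red 2 by auto
    have "b = 2" using \<open>G \<le> 4\<close> red(3) 2 t unfolding G_def by auto
    then have G: "G = 4 - t\<^sup>2" using 2 by (simp add: G_def)
    have H: "H = 2 * c - s\<^sup>2" using 2 by (simp add: H_def)
    have u: "u = 2 * r - s * t" using 2 by (simp add: u_def)
    have E: "G * H - u\<^sup>2 = 12" using GHu(4) 2 by simp
    have u': "u = -2 \<or> u = -1 \<or> u = 0 \<or> u = 1 \<or> u = 2" using GHu(3) \<open>G \<le> 4\<close> by auto
    have H4: "s = 0 \<and> c = 2" if "H = 4" using that s unfolding H by (auto, presburger+)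
    \<comment> \<open>The third class appears with several placements and signs of its mixed term;
      instead of normalizing them, a square modulo 3 is exhibited for each.\<close>
    have "\<exists>v N. m = v\<^sup>2 + 3 * N"
    proof (cases "t = 0")
      case True
      have "even u" using u True by simp
      then have "u = -2 \<or> u = 0 \<or> u = 2" using u' by auto
      moreover have "4 * H - u\<^sup>2 = 12" "4 \<le> H" using E GHu(2) True unfolding G by simp_all
      \<comment> \<open>Here u = 0 would give H = 3, below G = 4.\<close>
      ultimately have "u = -2 \<or> u = 2" "H = 4" by auto
      then have r: "r = -1 \<or> r = 1" "s = 0" "c = 2" using H4 u True by auto
      then have "m = (y + r * z)\<^sup>2 + 3 * (x\<^sup>2 + y\<^sup>2 + z\<^sup>2 - 2 * r * y * z)"
        using m(1) 2 \<open>b = 2\<close> True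
        by (auto simp: adjoint_form_def power2_eq_square algebra_simps)
      then show ?thesis by blast
    next
      case False
      then have t1: "t = -1 \<or> t = 1" using t by simp
      have "t\<^sup>2 = 1" using t1 by auto
      then have "3 * H - u\<^sup>2 = 12" "u = -1 \<or> u = 0 \<or> u = 1" using E GHu(3) unfolding G by auto
      then have "u = 0" "H = 4" by (elim disjE; simp; presburger)+
      then have "r = 0" "s = 0" "c = 2" using H4 u by auto
      then have "m = (x + t * y)\<^sup>2 + 3 * (x\<^sup>2 + y\<^sup>2 + z\<^sup>2 - 2 * t * x * y)"
        using m(1) 2 \<open>b = 2\<close> t1
        by (auto simp: adjoint_form_def power2_eq_square algebra_simps)
      then show ?thesis by blast
    qed
    then obtain v N where "m = v\<^sup>2 + 3 * N" by blast
    then have "m mod 3 = v\<^sup>2 mod 3" by (simp only: mod_mult_self2)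
    then show ?thesis using m(2) square_mod_3[of v] by simp
  qed
qed

text \<open>Gauss's reduction, alternating between a section of the form and a section of the
  adjoint. Swapping x and y lowers \<open>a\<close>; swapping y and z keeps \<open>a\<close> and
  lowers the minor, hence the lexicographic order. When neither swap helps, the form is
  reduced.\<close>

lemma det_6_adjoint:
  assumes "a > 0" "a * b - t\<^sup>2 > 0" "ternary_det a b c r s t = 6"
    and "adjoint_form a b c r s t x y z = m" "m mod 3 = 2"
  shows "\<exists>x y z. m = 2 * x\<^sup>2 + 3 * y\<^sup>2 + 6 * z\<^sup>2"
  using assms(1-4)
proof (induction "(nat a, nat (a * b - t\<^sup>2))" arbitrary: a b c r s t x y z
    rule: wf_induct_rule[OF wf_lex_prod[OF wf_less_than wf_less_than]])
  case (1 a b t c r s x y z)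
  note IH = 1(1) and pos = 1(2,3) and det = 1(4) and rep = 1(5)
  obtain k where k: "\<bar>2 * (t + k * a)\<bar> \<le> a" using nearest_multiple[OF pos(1)] .
  define b1 where "b1 = b + 2 * k * t + k\<^sup>2 * a"
  define r1 where "r1 = r + k * s"
  define t1 where "t1 = t + k * a"
  define y1 where "y1 = y + k * x"
  have rep1: "adjoint_form a b1 c r1 s t1 x y1 z = m"
    unfolding b1_def r1_def t1_def y1_def adjoint_form_shear_yx by (rule rep)
  have det1: "ternary_det a b1 c r1 s t1 = 6"
    unfolding b1_def r1_def t1_def ternary_det_shear_yx by (rule det)
  have minor1: "a * b1 - t1\<^sup>2 = a * b - t\<^sup>2" unfolding b1_def t1_def by (rule minor_shear_yx)
  have t1: "\<bar>2 * t1\<bar> \<le> a" using k t1_def by simp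
  have "a * b1 > 0" using minor1 pos(2) zero_le_power2[of t1] by linarith
  then have b1: "b1 > 0" using pos(1) by (simp add: zero_less_mult_iff)
  show ?case
  proof (cases "b1 < a")
    case True
    show ?thesis
    proof (rule IH)
      show "((nat b1, nat (b1 * a - t1\<^sup>2)), (nat a, nat (a * b - t\<^sup>2))) \<in> less_than <*lex*> less_than"
        using True b1 by simp
      show "b1 * a - t1\<^sup>2 > 0" using minor1 pos(2) by (simp add: mult.commute)
      show "ternary_det b1 a c s r1 t1 = 6" using det1 ternary_det_swap_xy by simp
      show "adjoint_form b1 a c s r1 t1 y1 x z = m" using rep1 adjoint_form_swap_xy by simp
    qed (rule b1)
  next
    case False
    define G where "G = a * b1 - t1\<^sup>2"
    have G: "G > 0" using minor1 pos(2) G_def by simp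
    \<comment> \<open>Adding \<open>l\<close> times the second basis vector to the third shifts the
      mixed entry of the adjoint section by \<open>l * G\<close>.\<close>
    obtain l where l: "\<bar>2 * ((a * r1 - s * t1) + l * G)\<bar> \<le> G" using nearest_multiple[OF G] .
    define c2 where "c2 = c + 2 * l * r1 + l\<^sup>2 * b1"
    define r2 where "r2 = r1 + l * b1"
    define s2 where "s2 = s + l * t1"
    define z2 where "z2 = z + l * y1"
    have rep2: "adjoint_form a b1 c2 r2 s2 t1 x y1 z2 = m"
      unfolding c2_def r2_def s2_def z2_def adjoint_form_shear_zy by (rule rep1)
    have det2: "ternary_det a b1 c2 r2 s2 t1 = 6"
      unfolding c2_def r2_def s2_def ternary_det_shear_zy by (rule det1)
    have u2: "\<bar>2 * (a * r2 - s2 * t1)\<bar> \<le> G"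
    proof -
      have "a * r2 - s2 * t1 = (a * r1 - s * t1) + l * G"
        by (simp add: r2_def s2_def G_def power2_eq_square algebra_simps)
      then show ?thesis using l by simp
    qed
    \<comment> \<open>Adding a multiple of the first basis vector to the third now makes
      \<open>s\<close> small without disturbing that entry.\<close>
    obtain j where j: "\<bar>2 * (s2 + j * a)\<bar> \<le> a" using nearest_multiple[OF pos(1)] .
    define c3 where "c3 = c2 + 2 * j * s2 + j\<^sup>2 * a"
    define r3 where "r3 = r2 + j * t1"
    define s3 where "s3 = s2 + j * a"
    define z3 where "z3 = z2 + j * x"
    have rep3: "adjoint_form a b1 c3 r3 s3 t1 x y1 z3 = m"
      unfolding c3_def r3_def s3_def z3_def adjoint_form_shear_zx by (rule rep2)
    have det3: "ternary_det a b1 c3 r3 s3 t1 = 6"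
      unfolding c3_def r3_def s3_def ternary_det_shear_zx by (rule det2)
    have u3: "\<bar>2 * (a * r3 - s3 * t1)\<bar> \<le> a * b1 - t1\<^sup>2"
    proof -
      have "a * r3 - s3 * t1 = a * r2 - s2 * t1" by (simp add: r3_def s3_def algebra_simps)
      then show ?thesis using u2 G_def by simp
    qed
    have s3: "\<bar>2 * s3\<bar> \<le> a" using j s3_def by simp
    have "G * (a * c3 - s3\<^sup>2) = 6 * a + (a * r3 - s3 * t1)\<^sup>2"
      using adjoint_minor_identity[of a b1 t1 c3 s3 r3] det3 G_def by simp
    also have "\<dots> > 0" using pos(1) by (simp add: add_pos_nonneg)
    finally have H: "a * c3 - s3\<^sup>2 > 0" using G by (simp add: zero_less_mult_iff)
    show ?thesis
    proof (cases "a * c3 - s3\<^sup>2 < G")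
      case True
      show ?thesis
      proof (rule IH)
        show "((nat a, nat (a * c3 - s3\<^sup>2)), (nat a, nat (a * b - t\<^sup>2))) \<in> less_than <*lex*> less_than"
          using True H minor1 G_def by simp
        show "ternary_det a c3 b1 r3 t1 s3 = 6" using det3 ternary_det_swap_yz by simp
        show "adjoint_form a c3 b1 r3 t1 s3 x z3 y1 = m" using rep3 adjoint_form_swap_yz by simp
      qed (rule pos(1), rule H)
    next
      case False
      then show ?thesis
        using reduced_det_6[OF pos(1) _ det3 t1 s3 _ u3 _ rep3 assms(5)] \<open>\<not> b1 < a\<close> G G_def by simp
    qed
  qed
qed

section \<open>The form of determinant 19\<close>

text \<open>Residue 7 modulo 8 has to be left out: there y would be odd and x^2 + 3z^2 would be 2
  modulo 4, which is impossible.\<close>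

lemma ternary_2_3_6_represents:
  fixes m :: int
  assumes "m > 0" "m mod 3 = 2" "m mod 4 = 1 \<or> m mod 8 = 3 \<or> m mod 4 = 2"
  shows "\<exists>x y z. m = 2 * x\<^sup>2 + 3 * y\<^sup>2 + 6 * z\<^sup>2"
proof -
  have "\<exists>k::nat. k > 0 \<and> odd k \<and> \<not> 3 dvd k \<and>
      (m = int k \<and> k mod 4 = 1 \<or> m = int k \<and> k mod 24 = 11 \<or> m = 2 * int k)"
  proof (cases "m mod 4 = 2")
    case True
    have "even m" using True by presburger
    then obtain j where "m = 2 * j" by blast
    then obtain k where mk: "m = 2 * int k" using assms(1) nonneg_int_cases[of j] by auto
    have "odd k" "\<not> 3 dvd k" using True assms(2) unfolding mk by presburger+
    moreover have "k > 0" using mk assms(1) by simp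
    ultimately show ?thesis using mk by blast
  next
    case False
    obtain k where mk: "m = int k" using assms(1) nonneg_int_cases[of m] by auto
    have m48: "int k mod 4 = 1 \<or> int k mod 8 = 3" using False assms(3) mk by simp
    then have "odd k" by (elim disjE) presburger+
    moreover have "\<not> 3 dvd k" using assms(2) unfolding mk by presburger
    moreover have "k mod 4 = 1 \<or> k mod 24 = 11"
    proof (cases "k mod 4 = 1")
      case False
      then have "int k mod 4 \<noteq> 1" by presburger
      then have "int k mod 8 = 3" using m48 by blast
      then have "k mod 8 = 3" by presburger
      moreover have "k mod 3 = 2" using assms(2) unfolding mk by presburger
      moreover have "k mod 24 mod 8 = k mod 8" "k mod 24 mod 3 = k mod 3" by (simp_all add: mod_mod_cancel)
      moreover have "r = 11" if "r mod 8 = 3" "r mod 3 = 2" "r < 24" for r :: nat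
        using that by presburger
      ultimately have "k mod 24 = 11" by simp
      then show ?thesis ..
    qed simp
    moreover have "k > 0" using mk assms(1) by simp
    ultimately show ?thesis using mk by blast
  qed
  then obtain k :: nat where k: "k > 0" "odd k" "\<not> 3 dvd k"
      "m = int k \<and> k mod 4 = 1 \<or> m = int k \<and> k mod 24 = 11 \<or> m = 2 * int k" by blast
  obtain q b c f g where q: "q > 0" "q * c - b\<^sup>2 = m" "m * g - q * f\<^sup>2 = 6"
    using exists_binary_corner[OF k] .
  have "ternary_det q c g f 0 b = 6"
    using q(3) unfolding q(2)[symmetric] ternary_det_def by (simp add: algebra_simps)
  \<comment> \<open>The coefficient of z^2 in the adjoint is the determinant of the section z =
    0.\<close>
  moreover have "adjoint_form q c g f 0 b 0 0 1 = m" using q(2) by (simp add: adjoint_form_def)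
  moreover have "q * c - b\<^sup>2 > 0" using q(2) assms(1) by simp
  ultimately show ?thesis using det_6_adjoint q(1) assms(2) by blast
qed

text \<open>Nonzero residues modulo 3 agree up to sign, and the square does not see the sign of
  \<open>X\<close>.\<close>

lemma exists_congruent_up_to_sign:
  fixes X a :: int
  assumes "\<not> 3 dvd X" "\<not> 3 dvd a"
  shows "\<exists>z. X\<^sup>2 = (3 * z + a)\<^sup>2"
proof -
  have "\<exists>u. X = 3 * u + 1 \<or> X = 3 * u + 2" "\<exists>v. a = 3 * v + 1 \<or> a = 3 * v + 2"
    using assms by presburger+
  then obtain u v where "X = 3 * u + 1 \<or> X = 3 * u + 2" "a = 3 * v + 1 \<or> a = 3 * v + 2"
    by blast
  then have "X = 3 * (u - v) + a \<or> - X = 3 * (- u - v - 1) + a" by auto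
  then show ?thesis by (metis power2_minus)
qed

text \<open>Undoing the completion of squares requires X = w or -w modulo 3 and Y = w modulo 2. The
  equation forces both: the first because 3 does not divide \<open>w\<close>, the second by
  parity.\<close>

lemma Q19_2_represents_via_w:
  assumes w: "w = 1 \<or> w = 2"
    and m: "6 * n - 19 * w\<^sup>2 = 2 * X\<^sup>2 + 3 * Y\<^sup>2 + 6 * x\<^sup>2"
  shows "\<exists>y z. Q19_2 x y z w = n"
proof -
  have "\<not> 3 dvd X"
  proof
    assume "3 dvd X"
    then obtain v where "X = 3 * v" by blast
    then have "19 * w\<^sup>2 = 3 * (2 * n - (6 * v\<^sup>2 + Y\<^sup>2 + 2 * x\<^sup>2))"
      using m by (simp add: power_mult_distrib)
    then have "3 dvd 19 * w\<^sup>2" by (rule dvdI)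
    then show False using w by auto
  qed
  moreover have "\<not> 3 dvd w" using w by auto
  ultimately obtain z where z: "X\<^sup>2 = (3 * z + w)\<^sup>2" using exists_congruent_up_to_sign by blast
  have "even (3 * Y\<^sup>2 + 19 * w\<^sup>2)"
  proof -
    have "3 * Y\<^sup>2 + 19 * w\<^sup>2 = 2 * (3 * n - X\<^sup>2 - 3 * x\<^sup>2)" using m by simp
    then show ?thesis by simp
  qed
  then have "even (Y - w)" by simp
  then obtain y where "Y = 2 * y + w" by (metis add.commute diff_add_cancel dvdE)
  then have "6 * Q19_2 x y z w = 6 * n"
    using m unfolding z Q19_2_def by (simp add: power2_eq_square algebra_simps)
  then show ?thesis by auto
qed

theorem theorem4p4: "primitively_universal Q19_2"
  unfolding primitively_universal_def
proof (intro allI impI)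
  fix n :: int assume n: "n > 0"
  \<comment> \<open>6n - 19 is positive from n = 4 on and 6n - 76 from n = 13 on, which leaves 1, 2,
    3, 7 and 11.\<close>
  have "(n < 4 \<or> n = 7 \<or> n = 11) \<or> n \<ge> 4 \<and> n mod 4 \<noteq> 3 \<or> n \<ge> 13 \<and> n mod 4 = 3"
    by presburger
  then consider "n < 4 \<or> n = 7 \<or> n = 11" | "n \<ge> 4" "n mod 4 \<noteq> 3" | "n \<ge> 13" "n mod 4 = 3"
    by blast
  then show "\<exists>x y z w. Q19_2 x y z w = n \<and> Gcd {x, y, z, w} = 1"
  proof cases
    case 1
    then have "n = 1 \<or> n = 2 \<or> n = 3 \<or> n = 7 \<or> n = 11" using n by auto
    then show ?thesis
    proof (elim disjE)
      assume "n = 1"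
      then have "Q19_2 1 0 0 0 = n \<and> Gcd {1, 0, 0, 0} = (1 :: int)" by (simp add: Q19_2_def)
      then show ?thesis by blast
    next
      assume "n = 2"
      then have "Q19_2 0 1 0 0 = n \<and> Gcd {0, 1, 0, 0} = (1 :: int)" by (simp add: Q19_2_def)
      then show ?thesis by blast
    next
      assume "n = 3"
      then have "Q19_2 1 1 0 0 = n \<and> Gcd {1, 1, 0, 0} = (1 :: int)" by (simp add: Q19_2_def)
      then show ?thesis by blast
    next
      assume "n = 7"
      then have "Q19_2 2 0 1 0 = n \<and> Gcd {2, 0, 1, 0} = (1 :: int)" by (simp add: Q19_2_def)
      then show ?thesis by blast
    next
      assume "n = 11"
      then have "Q19_2 3 1 0 0 = n \<and> Gcd {3, 1, 0, 0} = (1 :: int)" by (simp add: Q19_2_def)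
      then show ?thesis by blast
    qed
  next
    case 2
    have "\<exists>j. n = 4 * j \<or> n = 4 * j + 1 \<or> n = 4 * j + 2" using 2(2) by presburger
    then obtain j where "n = 4 * j \<or> n = 4 * j + 1 \<or> n = 4 * j + 2" by blast
    \<comment> \<open>The three classes of n give 5, 11 and 17 modulo 24.\<close>
    moreover have "(6 * (4 * j) - 19) mod 4 = 1" "(6 * (4 * j + 1) - 19) mod 8 = 3"
      "(6 * (4 * j + 2) - 19) mod 4 = 1" by presburger+
    ultimately have "(6 * n - 19) mod 4 = 1 \<or> (6 * n - 19) mod 8 = 3" by metis
    moreover have "(6 * n - 19) mod 3 = 2" by presburger
    moreover have "6 * n - 19 > 0" using 2(1) by simp
    ultimately obtain X Y x where "6 * n - 19 = 2 * X\<^sup>2 + 3 * Y\<^sup>2 + 6 * x\<^sup>2"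
      using ternary_2_3_6_represents by blast
    then obtain y z where "Q19_2 x y z 1 = n"
      using Q19_2_represents_via_w[of 1 n X Y x] by auto
    moreover have "Gcd {x, y, z, 1} = 1" by simp
    ultimately show ?thesis by blast
  next
    case 3
    have "6 * n - 76 > 0" using 3(1) by simp
    moreover have "(6 * n - 76) mod 3 = 2" by presburger
    moreover have "(6 * n - 76) mod 4 = 2" using 3(2) by presburger
    ultimately obtain X Y x where "6 * n - 76 = 2 * X\<^sup>2 + 3 * Y\<^sup>2 + 6 * x\<^sup>2"
      using ternary_2_3_6_represents by blast
    then obtain y z where yz: "Q19_2 x y z 2 = n"
      using Q19_2_represents_via_w[of 2 n X Y x] by auto
    \<comment> \<open>A common divisor divides \<open>w = 2\<close>. Modulo 2 only x^2 + 3z^2 is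
      left of the form, so \<open>x\<close> and \<open>z\<close> are not both even.\<close>
    have "odd n" using 3(2) by presburger
    then have "odd (x\<^sup>2 + 3 * z\<^sup>2)" using yz by (auto simp: Q19_2_def)
    then have "odd (gcd x z)" by auto
    then have "coprime (gcd x z) 2" by simp
    then have "gcd x (gcd y (gcd z 2)) = 1" 
      by (metis coprime_iff_gcd_eq_1 gcd.assoc gcd.commute gcd_1_int)
    then have "Gcd {x, y, z, 2} = 1" by simp
    then show ?thesis using yz by blast
  qed
qed

end
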